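(* There is a universal constant $K$ such that the following holds. Let $n\ge m\ge 1$ be integers, let $Y\in\mathbb{R}^{n\times m}$ be any matrix, let $s\ge 1$ be an integer (the sample size), let $r\ge 1$, let $p$ be any probability distribution on $[n]\times[m]$, and let $\ell$ be an $l$-Lipschitz loss bounded by $b$. Given a sample $S=((i_1,j_1),\dots,(i_s,j_s))$ drawn i.i.d. from $p$, let $\hat X_S\in\arg\min\{\hat L_S(X): X\in\mathcal{W}_r[p]\}$. Then $$\mathbf{E}_S\big[L_p(\hat X_S)\big]\le \inf_{X\in\mathcal{W}_r[p]}L_p(X)+K\,(l+b)\,\sqrt[3]{\frac{rn\log(n)}{s}}.$$
   Context: For a probability distribution $p$ on $[n]\times[m]$, $p^r(i)=\sum_j p(i,j)$ and $p^c(j)=\sum_i p(i,j)$ are its row and column marginals. $\|\cdot\|_{\mathrm{tr}}$ is the trace-norm (sum of singular values). For nonnegative weight vectors $q^r\in\mathbb{R}^n$, $q^c\in\mathbb{R}^m$, the weighted trace-norm of $X\in\mathbb{R}^{n\times m}$ is $\|X\|_{\mathrm{tr}(q^r,q^c)}=\|\mathrm{diag}(q^r)^{1/2}\,X\,\mathrm{diag}(q^c)^{1/2}\|_{\mathrm{tr}}$, and $\mathcal{W}_r[q]=\{X\in\mathbb{R}^{n\times m}:\|X\|_{\mathrm{tr}(q^r,q^c)}\le\sqrt r\}$ (in $\mathcal{W}_r$, the subscript $r$ is the number $r$; in $q^r,p^r$ the superscript $r$ stands for "row"). A loss is a function $\ell:\mathbb{R}\times\mathbb{R}\to\mathbb{R}$;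 it is $l$-Lipschitz if $|\ell(x,y)-\ell(x',y)|\le l|x-x'|$ for all $x,x',y$, and bounded by $b$ if $|\ell(x,y)|\le b$ for all $x,y$. The expected loss is $L_p(X)=\sum_{i,j}p(i,j)\,\ell(X_{ij},Y_{ij})$ and the empirical loss is $\hat L_S(X)=\frac1s\sum_{t=1}^s\ell(X_{i_tj_t},Y_{i_tj_t})$. $\hat X_S$ is any choice of minimizer. *)

theory Defs
  imports
    "HOL-Probability.Probability"
    "Jordan_Normal_Form.Char_Poly"
begin

text \<open>
  Real \<open>n\<close> by \<open>m\<close> matrices are elements of \<open>carrier_mat n m\<close>, so that the dimensions can be
  quantified over in a formula. The index sets \<open>[n]\<close> and \<open>[m]\<close> are \<open>{..<n}\<close> and \<open>{..<m}\<close>.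
\<close>

text \<open>
  Singular values are the square roots of the eigenvalues of \<open>A\<^sup>T A\<close>, with multiplicity. These
  eigenvalues are real and nonnegative, so the real characteristic polynomial splits and no
  eigenvalue is lost. If \<open>A\<close> has more columns than rows, there are extra zeros in the multiset.
\<close>

definition singular_values :: "real mat \<Rightarrow> real multiset" where
  "singular_values A = image_mset sqrt (proots (char_poly (transpose_mat A * A)))"

definition trace_norm :: "real mat \<Rightarrow> real" where
  "trace_norm A = sum_mset (singular_values A)"

definition weighted_trace_norm :: "(nat \<Rightarrow> real) \<Rightarrow> (nat \<Rightarrow> real) \<Rightarrow> real mat \<Rightarrow> real" where
  "weighted_trace_norm qr qc X =
     trace_norm (mat_diag (dim_row X) (\<lambda>i. sqrt (qr i)) * X * mat_diag (dim_col X) (\<lambda>j. sqrt (qc j)))"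

definition row_marginal :: "nat \<Rightarrow> (nat \<times> nat) pmf \<Rightarrow> nat \<Rightarrow> real" where
  "row_marginal m p i = (\<Sum>j<m. pmf p (i, j))"

definition col_marginal :: "nat \<Rightarrow> (nat \<times> nat) pmf \<Rightarrow> nat \<Rightarrow> real" where
  "col_marginal n p j = (\<Sum>i<n. pmf p (i, j))"

definition weighted_class :: "nat \<Rightarrow> nat \<Rightarrow> real \<Rightarrow> (nat \<times> nat) pmf \<Rightarrow> real mat set" where
  "weighted_class n m r p =
     {X \<in> carrier_mat n m.
        weighted_trace_norm (row_marginal m p) (col_marginal n p) X \<le> sqrt r}"

definition lipschitz_loss :: "real \<Rightarrow> (real \<Rightarrow> real \<Rightarrow> real) \<Rightarrow> bool" where
  "lipschitz_loss l loss \<longleftrightarrow> (\<forall>x x' y. \<bar>loss x y - loss x' y\<bar> \<le> l * \<bar>x - x'\<bar>)"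

definition bounded_loss :: "real \<Rightarrow> (real \<Rightarrow> real \<Rightarrow> real) \<Rightarrow> bool" where
  "bounded_loss b loss \<longleftrightarrow> (\<forall>x y. \<bar>loss x y\<bar> \<le> b)"

definition expected_loss ::
  "nat \<Rightarrow> nat \<Rightarrow> (real \<Rightarrow> real \<Rightarrow> real) \<Rightarrow> real mat \<Rightarrow> (nat \<times> nat) pmf \<Rightarrow> real mat \<Rightarrow> real" where
  "expected_loss n m loss Y p X =
     (\<Sum>i<n. \<Sum>j<m. pmf p (i, j) * loss (X $$ (i, j)) (Y $$ (i, j)))"

definition empirical_loss ::
  "(real \<Rightarrow> real \<Rightarrow> real) \<Rightarrow> real mat \<Rightarrow> (nat \<times> nat) list \<Rightarrow> real mat \<Rightarrow> real" where
  "empirical_loss loss Y S X =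
     1 / real (length S) * (\<Sum>(i, j)\<leftarrow>S. loss (X $$ (i, j)) (Y $$ (i, j)))"

end

theory Submission
  imports
    Defs
    "Jordan_Normal_Form.Schur_Decomposition"
begin

text \<open>
  Fix a threshold \<open>\<alpha>\<close> and call an entry heavy if both its row and its column marginal are at least
  \<open>\<alpha>\<close>. The light entries have total mass at most \<open>2 n \<alpha>\<close>, and since the loss is bounded they cost
  only \<open>O(b n \<alpha>)\<close>. On the heavy entries, symmetrization and contraction bound the excess risk by the
  Rademacher complexity of the weighted trace-norm ball, which by duality is the expected spectral
  norm of \<open>M = \<Sum>\<^sub>t \<epsilon>\<^sub>t E(i\<^sub>t,j\<^sub>t) / sqrt (p\<^sup>r(i\<^sub>t) p\<^sup>c(j\<^sub>t))\<close>. Conditionally on the sample, a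
  Khintchine inequality for even trace moments of order about \<open>log n\<close> bounds this norm by
  \<open>sqrt (log n \<sqdot> V)\<close>, where \<open>V\<close> is the largest row or column sum of the squared weights; a Chernoff
  argument gives \<open>E V = O(s / \<alpha>)\<close>. The sum \<open>b n \<alpha> + l sqrt (r log n / (s \<alpha>))\<close> is balanced by
  \<open>(n \<alpha>)\<^sup>3 = r n log n / s\<close>.
\<close>

unbundle no vec_syntax

section \<open>Spectral theorem for real symmetric matrices\<close>

text \<open>The support of the sample is finite, so the minimizers that can occur form one finite
  class fixed before the draw: suprema become \<open>Max\<close> and expectations become finite
  sums. The proof is shaped by the fact that the ball is weighted by p itself, unsmoothed. Where a
  marginal is small, the norm hardly constrains the entries and the dual weights blow up. Truncation
  at \<alpha> trades this for a bias that only boundedness of the loss controls; a bias linear in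
  \<alpha> against a complexity of order \<open>\<alpha>^(-1/2)\<close> is what produces a cube
  root. The exponent -1/2 requires averaging over the sample: the squared heavy weights are only
  bounded by \<open>1 / \<alpha>^2\<close> pointwise, but in the expected row or column sum one
  marginal cancels against the probability of the row or column, which leaves
  \<open>s / \<alpha>\<close>. Two regimes escape the balance. For n = 1 the logarithm vanishes and
  the excess risk must be exactly zero; if the cube root exceeds 1, the bound already follows from
  boundedness.\<close>

lemma real_symmetric_eigenvector:
  fixes H :: "real mat"
  assumes H: "H \<in> carrier_mat n n" and sym: "transpose_mat H = H" and n: "n > 0"
  shows "\<exists>v e. v \<in> carrier_vec n \<and> v \<noteq> 0\<^sub>v n \<and> H *\<^sub>v v = e \<cdot>\<^sub>v v"
proof -
  let ?HC = "map_mat complex_of_real H"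
  have HC: "?HC \<in> carrier_mat n n" using H by simp
  have "degree (char_poly ?HC) = n" using degree_monic_char_poly[OF HC] by simp
  then have "\<not> constant (poly (char_poly ?HC))" using n by (simp add: constant_degree)
  then obtain c where c: "poly (char_poly ?HC) c = 0"
    using fundamental_theorem_of_algebra by blast
  then have "eigenvalue ?HC c" using eigenvalue_root_char_poly[OF HC] by simp
  then obtain z where z: "z \<in> carrier_vec n" "z \<noteq> 0\<^sub>v n" "?HC *\<^sub>v z = c \<cdot>\<^sub>v z"
    using H unfolding eigenvalue_def eigenvector_def by auto
  have Hs: "H $$ (j,i) = H $$ (i,j)" if "i < n" "j < n" for i j
    using sym H that by (metis carrier_matD index_transpose_mat(1))
  have ev: "(\<Sum>j<n. complex_of_real (H $$ (i,j)) * z $ j) = c * z $ i" if i: "i < n" for i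
  proof -
    have "(?HC *\<^sub>v z) $ i = c * z $ i" using z i by simp
    moreover have "(?HC *\<^sub>v z) $ i = (\<Sum>j<n. complex_of_real (H $$ (i,j)) * z $ j)"
      using H z(1) i by (auto simp: scalar_prod_def atLeast0LessThan intro!: sum.cong)
    ultimately show ?thesis by simp
  qed
  \<comment> \<open>The Hermitian form \<open>z^* H z\<close>. It equals \<open>c |z|^2\<close> and
    is its own conjugate because H is real symmetric; hence c is real.\<close>
  define q where "q = (\<Sum>i<n. \<Sum>j<n. cnj (z $ i) * complex_of_real (H $$ (i,j)) * z $ j)"
  have q1: "q = c * complex_of_real (\<Sum>i<n. (norm (z $ i))\<^sup>2)"
  proof -
    have "q = (\<Sum>i<n. cnj (z $ i) * (\<Sum>j<n. complex_of_real (H $$ (i,j)) * z $ j))"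
      by (simp add: q_def sum_distrib_left mult.assoc)
    also have "\<dots> = (\<Sum>i<n. cnj (z $ i) * (c * z $ i))" using ev by simp
    also have "\<dots> = (\<Sum>i<n. c * complex_of_real ((norm (z $ i))\<^sup>2))"
      by (intro sum.cong refl) (metis complex_norm_square mult.commute mult.left_commute)
    finally show ?thesis by (simp add: sum_distrib_left)
  qed
  have "cnj q = (\<Sum>i<n. \<Sum>j<n. z $ i * complex_of_real (H $$ (i,j)) * cnj (z $ j))"
    by (simp add: q_def)
  also have "\<dots> = (\<Sum>j<n. \<Sum>i<n. z $ i * complex_of_real (H $$ (i,j)) * cnj (z $ j))"
    by (rule sum.swap)
  also have "\<dots> = q" unfolding q_def
    by (intro sum.cong refl) (auto simp: Hs mult_ac)
  finally have qr: "cnj q = q" .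
  obtain k where k: "k < n" "z $ k \<noteq> 0" using z(1,2) by (metis carrier_vecD eq_vecI index_zero_vec)
  have pos: "(\<Sum>i<n. (norm (z $ i))\<^sup>2) > 0"
    using k by (intro sum_pos2[of _ k]) auto
  have "Im q = Im c * (\<Sum>i<n. (norm (z $ i))\<^sup>2)" unfolding q1 by simp
  moreover have "Im q = 0" using qr by (metis cnj.simps(2) neg_equal_zero)
  ultimately have c0: "Im c = 0" using pos by simp
  \<comment> \<open>With c and H real, the real and imaginary parts of z satisfy the eigenvalue
    equation separately, and at least one of them is nonzero.\<close>
  define x where "x = vec n (\<lambda>i. Re (z $ i))"
  define y where "y = vec n (\<lambda>i. Im (z $ i))"
  have hx: "H *\<^sub>v x = Re c \<cdot>\<^sub>v x"
  proof (rule eq_vecI)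
    fix i assume "i < dim_vec (Re c \<cdot>\<^sub>v x)"
    then have i: "i < n" by (simp add: x_def)
    have "(\<Sum>j<n. H $$ (i,j) * Re (z $ j)) = Re c * Re (z $ i)"
      using arg_cong[OF ev[OF i], of Re] c0 by simp
    then show "(H *\<^sub>v x) $ i = (Re c \<cdot>\<^sub>v x) $ i"
      using H i by (simp add: x_def scalar_prod_def atLeast0LessThan)
  qed (use H in \<open>simp add: x_def\<close>)
  have hy: "H *\<^sub>v y = Re c \<cdot>\<^sub>v y"
  proof (rule eq_vecI)
    fix i assume "i < dim_vec (Re c \<cdot>\<^sub>v y)"
    then have i: "i < n" by (simp add: y_def)
    have "(\<Sum>j<n. H $$ (i,j) * Im (z $ j)) = Re c * Im (z $ i)"
      using arg_cong[OF ev[OF i], of Im] c0 by simp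
    then show "(H *\<^sub>v y) $ i = (Re c \<cdot>\<^sub>v y) $ i"
      using H i by (simp add: y_def scalar_prod_def atLeast0LessThan)
  qed (use H in \<open>simp add: y_def\<close>)
  have "Re (z $ k) \<noteq> 0 \<or> Im (z $ k) \<noteq> 0" using k(2) by (simp add: complex_eq_iff)
  then have "x \<noteq> 0\<^sub>v n \<or> y \<noteq> 0\<^sub>v n" using k(1)
    by (metis index_vec index_zero_vec(1) x_def y_def)
  moreover have "x \<in> carrier_vec n" "y \<in> carrier_vec n" by (auto simp: x_def y_def)
  ultimately show ?thesis using hx hy by blast
qed

text \<open>The Householder reflection exchanging \<open>e\<^sub>0\<close> and \<open>v\<close>; it deflates one eigenvector in the induction.\<close>

lemma reflection_to_unit_vec:
  fixes v :: "real vec"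
  assumes v: "v \<in> carrier_vec n" "v \<bullet> v = 1" and n: "n > 0"
  shows "\<exists>W \<in> carrier_mat n n. transpose_mat W = W \<and> W * W = 1\<^sub>m n \<and> W *\<^sub>v unit_vec n 0 = v"
proof -
  have vv: "(\<Sum>j<n. v $ j * v $ j) = 1"
    using v by (auto simp: scalar_prod_def atLeast0LessThan)
  show ?thesis
  proof (cases "v $ 0 = 1")
    case True
    have "1 = v $ 0 * v $ 0 + (\<Sum>j\<in>{..<n}-{0}. v $ j * v $ j)"
      using vv n by (simp add: sum.remove[of "{..<n}" 0])
    then have "(\<Sum>j\<in>{..<n}-{0}. v $ j * v $ j) = 0" using True by simp
    then have "\<forall>j\<in>{..<n}-{0}. v $ j * v $ j = 0"
      by (subst (asm) sum_nonneg_eq_0_iff) auto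
    then have "v = unit_vec n 0" using v True by (intro eq_vecI) auto
    then show ?thesis by (intro bexI[of _ "1\<^sub>m n"]) auto
  next
    case False
    define w where "w i = v $ i - (if i = 0 then 1 else 0)" for i
    \<comment> \<open>The usual \<open>2 w w^T / |w|^2\<close>, because
      \<open>|w|^2 = 2 (1 - v_0)\<close>. The denominator vanishes only in the case
      \<open>v = e_0\<close> settled above.\<close>
    define W where "W = mat n n (\<lambda>(i,j). (if i = j then 1 else 0) - w i * w j / (1 - v $ 0))"
    have W: "W \<in> carrier_mat n n" by (simp add: W_def)
    have v0: "(\<Sum>j<n. (if j = 0 then 1 else 0) * f j) = f 0" for f :: "nat \<Rightarrow> real"
      using n by (simp add: if_distrib[of "\<lambda>x. x * _"] cong: if_cong)
    have ww: "(\<Sum>j<n. w j * w j) = 2 * (1 - v $ 0)"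
    proof -
      have "(\<Sum>j<n. w j * w j) = (\<Sum>j<n. v $ j * v $ j - (if j = 0 then 1 else 0) * (2 * v $ j - 1))"
        by (intro sum.cong) (auto simp: w_def algebra_simps)
      also have "\<dots> = 2 * (1 - v $ 0)" unfolding sum_subtractf v0 vv by simp
      finally show ?thesis .
    qed
    have "transpose_mat W = W" by (rule eq_matI) (auto simp: W_def)
    moreover have "W * W = 1\<^sub>m n"
    proof (rule eq_matI)
      fix i j assume "i < dim_row (1\<^sub>m n :: real mat)" "j < dim_col (1\<^sub>m n :: real mat)"
      then have ij: "i < n" "j < n" by auto
      let ?d = "\<lambda>i j. if i = j then 1 else 0 :: real"
      let ?a = "1 - v $ 0"
      have dl: "(\<Sum>k<n. ?d i k * f k) = f i" if "i < n" for f i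
        using that by (simp add: if_distrib[of "\<lambda>x. x * _"] cong: if_cong)
      have dr: "(\<Sum>k<n. ?d k j * f k) = f j" if "j < n" for f j
        using that by (simp add: if_distrib[of "\<lambda>x. x * _"] cong: if_cong)
      have "(W * W) $$ (i,j) = (\<Sum>k<n. (?d i k - w i * w k / ?a) * (?d k j - w k * w j / ?a))"
        using ij by (simp add: W_def scalar_prod_def atLeast0LessThan)
      also have "\<dots> = (\<Sum>k<n. ?d i k * ?d k j) - (\<Sum>k<n. ?d i k * (w k * w j / ?a))
          - (\<Sum>k<n. ?d k j * (w i * w k / ?a)) + w i * w j / ?a / ?a * (\<Sum>k<n. w k * w k)"
        unfolding sum_distrib_left sum_subtractf[symmetric] sum.distrib[symmetric]
        by (intro sum.cong) (auto simp: divide_inverse algebra_simps)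
      also have "\<dots> = ?d i j - w i * w j / ?a - w i * w j / ?a + w i * w j / ?a / ?a * (2 * ?a)"
        unfolding ww dl[OF ij(1)] dr[OF ij(2)] using ij by simp
      also have "\<dots> = ?d i j" using False by (simp add: nonzero_divide_eq_eq)
      finally show "(W * W) $$ (i,j) = 1\<^sub>m n $$ (i,j)" using ij by simp
    qed (auto simp: W_def)
    moreover have "W *\<^sub>v unit_vec n 0 = v"
    proof (rule eq_vecI)
      fix i assume "i < dim_vec v"
      then have i: "i < n" using v by simp
      have "(W *\<^sub>v unit_vec n 0) $ i = W $$ (i,0)" using i n W by simp
      also have "\<dots> = (if i = 0 then 1 else 0) - w i * (v $ 0 - 1) / (1 - v $ 0)"
        using i n by (simp add: W_def w_def)
      also have "w i * (v $ 0 - 1) / (1 - v $ 0) = - w i" using False by (simp add: field_simps)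
      finally show "(W *\<^sub>v unit_vec n 0) $ i = v $ i" by (simp add: w_def)
    qed (use v W in simp)
    ultimately show ?thesis using W by blast
  qed
qed

text \<open>Induction on the dimension. As W is a symmetric involution taking \<open>e_0\<close> to
  an eigenvector of H, the matrix \<open>G = W * H * W\<close> is symmetric with eigenvector
  \<open>e_0\<close>. This clears its first column off the diagonal, symmetry clears the first row,
  and the induction hypothesis treats the remaining block.\<close>

theorem real_symmetric_spectral:
  fixes H :: "real mat"
  assumes "H \<in> carrier_mat n n" "transpose_mat H = H"
  shows "\<exists>U lam. U \<in> carrier_mat n n \<and> transpose_mat U * U = 1\<^sub>m n \<and>
    H = U * mat_diag n lam * transpose_mat U"
  using assms
proof (induction n arbitrary: H)
  case 0
  then show ?case by (intro exI[of _ "1\<^sub>m 0"]) (auto intro!: eq_matI)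
next
  case (Suc k)
  note H = Suc.prems(1) and sym = Suc.prems(2)
  let ?n = "Suc k"
  obtain v0 e where v0: "v0 \<in> carrier_vec ?n" "v0 \<noteq> 0\<^sub>v ?n" "H *\<^sub>v v0 = e \<cdot>\<^sub>v v0"
    using real_symmetric_eigenvector[OF H sym] by blast
  define v where "v = (1 / sqrt (v0 \<bullet> v0)) \<cdot>\<^sub>v v0"
  have "v0 \<bullet> v0 > 0" using v0(1,2) conjugate_square_greater_0_vec[OF v0(1)] by simp
  then have v: "v \<in> carrier_vec ?n" "v \<bullet> v = 1" "H *\<^sub>v v = e \<cdot>\<^sub>v v"
    using v0 H by (auto simp: v_def mult_mat_vec[of _ ?n ?n] smult_smult_assoc mult.commute real_div_sqrt)
  obtain W where W: "W \<in> carrier_mat ?n ?n" "transpose_mat W = W" "W * W = 1\<^sub>m ?n"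
    "W *\<^sub>v unit_vec ?n 0 = v"
    using reflection_to_unit_vec[OF v(1,2)] by auto
  define G where "G = W * H * W"
  have G: "G \<in> carrier_mat ?n ?n" using W H by (simp add: G_def)
  have Gs: "transpose_mat G = G"
    using W H sym by (simp add: G_def transpose_mult[of _ ?n ?n _ ?n] assoc_mult_mat[of _ ?n ?n _ ?n _ ?n])
  have Wv: "W *\<^sub>v v = unit_vec ?n 0"
    using W by (metis assoc_mult_mat_vec one_mult_mat_vec unit_vec_carrier)
  have Ge: "G *\<^sub>v unit_vec ?n 0 = e \<cdot>\<^sub>v unit_vec ?n 0"
    using W H v(1,3) Wv unfolding G_def
    by (simp add: assoc_mult_mat_vec[of _ ?n ?n _ ?n] mult_mat_vec[of _ ?n ?n] del: mult_mat_vec_carrier)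
  have G0: "G $$ (i,0) = (if i = 0 then e else 0)" if "i < ?n" for i
    using arg_cong[OF Ge, of "\<lambda>w. w $ i"] that G by auto
  have G0': "G $$ (0,i) = (if i = 0 then e else 0)" if "i < ?n" for i
    using G0[OF that] Gs G that by (metis carrier_matD index_transpose_mat(1) zero_less_Suc)
  define H' where "H' = mat k k (\<lambda>(i,j). G $$ (Suc i, Suc j))"
  have Gb: "G = four_block_mat (mat 1 1 (\<lambda>_. e)) (0\<^sub>m 1 k) (0\<^sub>m k 1) H'"
  proof (rule eq_matI)
    fix i j
    assume "i < dim_row (four_block_mat (mat 1 1 (\<lambda>_. e)) (0\<^sub>m 1 k) (0\<^sub>m k 1) H')"
      "j < dim_col (four_block_mat (mat 1 1 (\<lambda>_. e)) (0\<^sub>m 1 k) (0\<^sub>m k 1) H')"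
    then have "i < ?n" "j < ?n" by (auto simp: H'_def)
    then show "G $$ (i,j) = four_block_mat (mat 1 1 (\<lambda>_. e)) (0\<^sub>m 1 k) (0\<^sub>m k 1) H' $$ (i,j)"
      using G0[of i] G0'[of j] by (cases i; cases j) (auto simp: H'_def)
  qed (use G in \<open>auto simp: H'_def\<close>)
  have H': "H' \<in> carrier_mat k k" by (simp add: H'_def)
  have "transpose_mat H' = H'"
    using Gs G by (intro eq_matI) (auto simp: H'_def, metis Suc_less_eq carrier_matD index_transpose_mat(1))
  then obtain U' lam' where U': "U' \<in> carrier_mat k k" "transpose_mat U' * U' = 1\<^sub>m k"
     "H' = U' * mat_diag k lam' * transpose_mat U'"
    using Suc.IH[OF H'] by blast
  define lam where "lam i = (case i of 0 \<Rightarrow> e | Suc j \<Rightarrow> lam' j)" for i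
  define B where "B = four_block_mat (1\<^sub>m 1) (0\<^sub>m 1 k) (0\<^sub>m k 1) U'"
  have B: "B \<in> carrier_mat ?n ?n" using four_block_carrier_mat[of "1\<^sub>m 1" 1 1 U' k k] U' by (simp add: B_def)
  have Bt: "transpose_mat B = four_block_mat (1\<^sub>m 1) (0\<^sub>m 1 k) (0\<^sub>m k 1) (transpose_mat U')"
    unfolding B_def by (subst transpose_four_block_mat[of _ 1 1 _ k _ k]) (use U' in auto)
  have BB: "transpose_mat B * B = 1\<^sub>m ?n"
    unfolding Bt unfolding B_def
    by (subst mult_four_block_mat[of _ 1 1 _ k _ k _ _ 1 _ k])
      (use U' in \<open>auto intro!: eq_matI\<close>)
  have D: "mat_diag ?n lam = four_block_mat (mat 1 1 (\<lambda>_. e)) (0\<^sub>m 1 k) (0\<^sub>m k 1) (mat_diag k lam')"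
    by (rule eq_matI) (auto simp: mat_diag_def lam_def split: nat.split)
  have GB: "G = B * mat_diag ?n lam * transpose_mat B"
  proof -
    have d: "mat_diag k lam' \<in> carrier_mat k k" "mat 1 1 (\<lambda>_. e) \<in> carrier_mat 1 1" by auto
    have "B * mat_diag ?n lam = four_block_mat (mat 1 1 (\<lambda>_. e)) (0\<^sub>m 1 k) (0\<^sub>m k 1) (U' * mat_diag k lam')"
      unfolding D unfolding B_def
      by (subst mult_four_block_mat[of _ 1 1 _ k _ k _ _ 1 _ k]) (use U' d in \<open>auto simp: left_mult_zero_mat[OF d(1)]\<close>)
    moreover have d': "U' * mat_diag k lam' \<in> carrier_mat k k"
        "U' * mat_diag k lam' * transpose_mat U' \<in> carrier_mat k k"
      using U' by auto
    ultimately have "B * mat_diag ?n lam * transpose_mat B =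
        four_block_mat (mat 1 1 (\<lambda>_. e)) (0\<^sub>m 1 k) (0\<^sub>m k 1) (U' * mat_diag k lam' * transpose_mat U')"
      unfolding Bt
      by (simp only:, subst mult_four_block_mat[of _ 1 1 _ k _ k _ _ 1 _ k])
        (use U' d d' in \<open>auto simp: right_mult_zero_mat[OF d'(1)] left_add_zero_mat[OF d'(2)]\<close>)
    then show ?thesis unfolding Gb U'(3) by simp
  qed
  have dd: "mat_diag ?n lam \<in> carrier_mat ?n ?n" by simp
  have "W * B \<in> carrier_mat ?n ?n" using W B by simp
  moreover have "transpose_mat (W * B) * (W * B) = 1\<^sub>m ?n"
  proof -
    have "transpose_mat (W * B) * (W * B) = transpose_mat B * (W * (W * B))"
      using W B by (simp add: transpose_mult[of _ ?n ?n _ ?n] assoc_mult_mat[of _ ?n ?n _ ?n _ ?n])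
    also have "W * (W * B) = B" using W B by (metis assoc_mult_mat left_mult_one_mat)
    finally show ?thesis using BB by simp
  qed
  moreover have "H = (W * B) * mat_diag ?n lam * transpose_mat (W * B)"
  proof -
    have "(W * B) * mat_diag ?n lam * transpose_mat (W * B) = W * (B * mat_diag ?n lam * transpose_mat B) * W"
      using W B mult_carrier_mat[OF dd, of "transpose_mat B" ?n]
        mult_carrier_mat[OF B mult_carrier_mat[OF dd, of "transpose_mat B" ?n]]
      by (simp add: transpose_mult[of _ ?n ?n _ ?n] assoc_mult_mat[of _ ?n ?n _ ?n _ ?n])
    also have "\<dots> = W * (W * H * W) * W" using GB G_def by simp
    also have "\<dots> = (W * W) * H * (W * W)" using W(1) H by (simp add: assoc_mult_mat[of _ ?n ?n _ ?n _ ?n])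
    also have "\<dots> = H" using W(3) H by simp
    finally show ?thesis by simp
  qed
  ultimately show ?case by blast
qed

section \<open>Trace-norm duality\<close>

text \<open>\<open>u k\<close> is the k-th eigenvector and \<open>u k a\<close> its a-th coordinate.
  The second clause is completeness, the form in which vectors are expanded in the basis. With plain
  functions on indices, spectral arguments become interchanges of finite sums.\<close>

definition eigenbasis :: "nat \<Rightarrow> (nat \<Rightarrow> nat \<Rightarrow> real) \<Rightarrow> (nat \<Rightarrow> nat \<Rightarrow> real) \<Rightarrow> (nat \<Rightarrow> real) \<Rightarrow> bool" where
  "eigenbasis d X u lam \<longleftrightarrow>
     (\<forall>k<d. \<forall>l<d. (\<Sum>a<d. u k a * u l a) = (if k = l then 1 else 0)) \<and>
     (\<forall>a<d. \<forall>b<d. (\<Sum>k<d. u k a * u k b) = (if a = b then 1 else 0)) \<and>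
     (\<forall>a<d. \<forall>b<d. X a b = (\<Sum>k<d. lam k * u k a * u k b))"

text \<open>The characteristic polynomial is recorded along with the basis because
  \<open>singular_values\<close> is defined by its roots; this ties their multiplicities to the
  eigenvectors.\<close>

lemma eigenbasis_exists:
  assumes "\<And>a b. a < d \<Longrightarrow> b < d \<Longrightarrow> X a b = X b a"
  shows "\<exists>u lam. eigenbasis d X u lam \<and> char_poly (mat d d (\<lambda>(a,b). X a b)) = (\<Prod>k<d. [:- lam k, 1:])"
proof -
  let ?H = "mat d d (\<lambda>(a,b). X a b)"
  have H: "?H \<in> carrier_mat d d" by simp
  moreover have "transpose_mat ?H = ?H" using assms by (intro eq_matI) auto
  ultimately obtain U lam where U: "U \<in> carrier_mat d d" "transpose_mat U * U = 1\<^sub>m d"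
    "?H = U * mat_diag d lam * transpose_mat U"
    using real_symmetric_spectral by blast
  have UU: "U * transpose_mat U = 1\<^sub>m d"
    using mat_mult_left_right_inverse[of "transpose_mat U" d U] U(1,2) by simp
  have "similar_mat_wit ?H (mat_diag d lam) U (transpose_mat U)"
    by (rule similar_mat_witI[of _ _ d]) (use U UU in auto)
  then have "char_poly ?H = char_poly (mat_diag d lam)"
    by (intro char_poly_similar) (auto simp: similar_mat_def)
  also have "\<dots> = (\<Prod>a\<leftarrow>diag_mat (mat_diag d lam). [:- a, 1:])"
    by (rule char_poly_upper_triangular[of _ d]) (auto simp: mat_diag_def)
  also have "diag_mat (mat_diag d lam) = map lam [0..<d]"
    by (auto simp: diag_mat_def mat_diag_def)
  also have "(\<Prod>a\<leftarrow>map lam [0..<d]. [:- a, 1:]) = (\<Prod>k<d. [:- lam k, 1:])"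
    by (subst prod.list_conv_set_nth) (auto simp: atLeast0LessThan)
  finally have cp: "char_poly ?H = (\<Prod>k<d. [:- lam k, 1:])" .
  define u where "u k a = U $$ (a,k)" for k a
  have "(\<Sum>a<d. u k a * u l a) = (if k = l then 1 else 0)" if "k < d" "l < d" for k l
    using arg_cong[OF U(2), of "\<lambda>M. M $$ (k,l)"] U(1) that
    by (simp add: u_def scalar_prod_def atLeast0LessThan)
  moreover have "(\<Sum>k<d. u k a * u k b) = (if a = b then 1 else 0)" if "a < d" "b < d" for a b
    using arg_cong[OF UU, of "\<lambda>M. M $$ (a,b)"] U(1) that
    by (simp add: u_def scalar_prod_def atLeast0LessThan)
  moreover have "X a b = (\<Sum>k<d. lam k * u k a * u k b)" if "a < d" "b < d" for a b
    using arg_cong[OF U(3), of "\<lambda>M. M $$ (a,b)"] U(1) that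
    by (simp add: u_def scalar_prod_def atLeast0LessThan mat_diag_mult_right[OF U(1)] mult_ac)
  ultimately have "eigenbasis d X u lam" unfolding eigenbasis_def by blast
  then show ?thesis using cp by blast
qed

lemma eigenbasis_vec:
  assumes "eigenbasis d X u lam" "k < d" "a < d"
  shows "(\<Sum>b<d. X a b * u k b) = lam k * u k a"
proof -
  have "(\<Sum>b<d. X a b * u k b) = (\<Sum>b<d. \<Sum>l<d. lam l * u l a * (u l b * u k b))"
  proof (rule sum.cong[OF refl])
    fix b assume "b \<in> {..<d}"
    then have "X a b = (\<Sum>l<d. lam l * u l a * u l b)" using assms by (simp add: eigenbasis_def)
    then show "X a b * u k b = (\<Sum>l<d. lam l * u l a * (u l b * u k b))"
      by (simp add: sum_distrib_right mult.assoc)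
  qed
  also have "\<dots> = (\<Sum>l<d. lam l * u l a * (\<Sum>b<d. u l b * u k b))"
    by (subst sum.swap) (simp add: sum_distrib_left)
  also have "\<dots> = (\<Sum>l<d. if l = k then lam l * u l a else 0)"
    using assms by (intro sum.cong) (auto simp: eigenbasis_def)
  also have "\<dots> = lam k * u k a" using assms by simp
  finally show ?thesis .
qed

lemma eigenbasis_expand:
  assumes "eigenbasis d X u lam" "a < d"
  shows "v a = (\<Sum>k<d. (\<Sum>b<d. u k b * v b) * u k a)"
proof -
  have "(\<Sum>k<d. (\<Sum>b<d. u k b * v b) * u k a) = (\<Sum>k<d. \<Sum>b<d. v b * (u k a * u k b))"
    unfolding sum_distrib_right by (simp add: mult_ac)
  also have "\<dots> = (\<Sum>b<d. \<Sum>k<d. v b * (u k a * u k b))" by (rule sum.swap)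
  also have "\<dots> = (\<Sum>b<d. v b * (\<Sum>k<d. u k a * u k b))" by (simp add: sum_distrib_left)
  also have "\<dots> = (\<Sum>b<d. if b = a then v b else 0)"
    using assms by (intro sum.cong) (auto simp: eigenbasis_def)
  also have "\<dots> = v a" using assms by simp
  finally show ?thesis by simp
qed

lemma eigenbasis_parseval:
  assumes "eigenbasis d X u lam"
  shows "(\<Sum>k<d. (\<Sum>a<d. u k a * v a) * (\<Sum>a<d. u k a * w a)) = (\<Sum>a<d. v a * w a)"
proof -
  have "(\<Sum>a<d. v a * w a) = (\<Sum>a<d. (\<Sum>k<d. (\<Sum>b<d. u k b * v b) * u k a) * w a)"
    by (intro sum.cong refl arg_cong2[of _ _ _ _ "(*)"] eigenbasis_expand[OF assms]) simp
  also have "\<dots> = (\<Sum>a<d. \<Sum>k<d. (\<Sum>b<d. u k b * v b) * (u k a * w a))"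
    by (simp only: sum_distrib_right mult.assoc)
  also have "\<dots> = (\<Sum>k<d. \<Sum>a<d. (\<Sum>b<d. u k b * v b) * (u k a * w a))" by (rule sum.swap)
  finally show ?thesis by (simp add: sum_distrib_left)
qed

lemma trace_norm_eq_sum_sqrt:
  assumes A: "A \<in> carrier_mat n m"
    and cp: "char_poly (transpose_mat A * A) = (\<Prod>k<m. [:- lam k, 1:])"
  shows "trace_norm A = (\<Sum>k<m. sqrt (lam k))"
proof -
  have "proots (char_poly (transpose_mat A * A)) = (\<Sum>k<m. {#lam k#})"
    unfolding cp by (subst proots_prod) auto
  moreover have "sum_mset (image_mset sqrt (\<Sum>k<j. {#lam k#})) = (\<Sum>k<j. sqrt (lam k))" for j
    by (induction j) auto
  ultimately show ?thesis unfolding trace_norm_def singular_values_def by simp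
qed

text \<open>The hypothesis on M bounds its operator norm by B. In an eigenbasis of
  \<open>A^T A\<close> the pairing is the sum over k of the inner products of \<open>A u_k\<close>
  and \<open>M u_k\<close>. Since \<open>|A u_k| = sqrt (lam k)\<close> and
  \<open>|M u_k| \<le> B\<close>, Cauchy-Schwarz applied to each term suffices.\<close>

lemma trace_norm_duality:
  assumes A: "A \<in> carrier_mat n m" and B: "B \<ge> 0"
    and M: "\<And>v. (\<Sum>i<n. (\<Sum>j<m. M i j * v j)\<^sup>2) \<le> B\<^sup>2 * (\<Sum>j<m. (v j)\<^sup>2)"
  shows "(\<Sum>i<n. \<Sum>j<m. A $$ (i,j) * M i j) \<le> B * trace_norm A"
proof -
  define H where "H a b = (\<Sum>i<n. A $$ (i,a) * A $$ (i,b))" for a b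
  have HA: "transpose_mat A * A = mat m m (\<lambda>(a,b). H a b)"
    using A by (intro eq_matI) (auto simp: H_def scalar_prod_def atLeast0LessThan)
  obtain u lam where u: "eigenbasis m H u lam" and "char_poly (mat m m (\<lambda>(a,b). H a b)) = (\<Prod>k<m. [:- lam k, 1:])"
    using eigenbasis_exists[of m H] by (auto simp: H_def mult.commute)
  then have tn: "trace_norm A = (\<Sum>k<m. sqrt (lam k))"
    using trace_norm_eq_sum_sqrt[OF A] HA by simp
  have Au: "(\<Sum>i<n. (\<Sum>j<m. A $$ (i,j) * u k j)\<^sup>2) = lam k" if k: "k < m" for k
  proof -
    have "(\<Sum>i<n. (\<Sum>j<m. A $$ (i,j) * u k j)\<^sup>2) =
        (\<Sum>i<n. \<Sum>a<m. \<Sum>b<m. u k a * (A $$ (i,a) * A $$ (i,b) * u k b))"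
      by (simp add: power2_eq_square sum_product mult_ac)
    also have "\<dots> = (\<Sum>a<m. u k a * (\<Sum>b<m. H a b * u k b))"
      unfolding H_def
      by (subst sum.swap, simp only: sum_distrib_left sum_distrib_right, subst (2) sum.swap) (rule refl)
    also have "\<dots> = (\<Sum>a<m. lam k * (u k a * u k a))"
      using eigenbasis_vec[OF u k] by (intro sum.cong) auto
    also have "\<dots> = lam k" using u k by (simp add: eigenbasis_def sum_distrib_left[symmetric])
    finally show ?thesis .
  qed
  have "(\<Sum>i<n. \<Sum>j<m. A $$ (i,j) * M i j) =
      (\<Sum>i<n. \<Sum>k<m. (\<Sum>j<m. u k j * A $$ (i,j)) * (\<Sum>j<m. u k j * M i j))"
    using eigenbasis_parseval[OF u] by simp
  also have "\<dots> = (\<Sum>k<m. \<Sum>i<n. (\<Sum>j<m. A $$ (i,j) * u k j) * (\<Sum>j<m. M i j * u k j))"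
    by (subst sum.swap) (simp add: mult.commute)
  also have "\<dots> \<le> (\<Sum>k<m. B * sqrt (lam k))"
  proof (rule sum_mono)
    fix k assume "k \<in> {..<m}"
    then have k: "k < m" by simp
    have l0: "lam k \<ge> 0" unfolding Au[OF k, symmetric] by (simp add: sum_nonneg)
    have "(\<Sum>j<m. (u k j)\<^sup>2) = 1" using u k by (simp add: eigenbasis_def power2_eq_square)
    then have Mu: "(\<Sum>i<n. (\<Sum>j<m. M i j * u k j)\<^sup>2) \<le> B\<^sup>2" using M[of "u k"] by simp
    have "((\<Sum>i<n. (\<Sum>j<m. A $$ (i,j) * u k j) * (\<Sum>j<m. M i j * u k j)))\<^sup>2 \<le>
       lam k * (\<Sum>i<n. (\<Sum>j<m. M i j * u k j)\<^sup>2)"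
      unfolding Au[OF k, symmetric] by (rule Cauchy_Schwarz_ineq_sum)
    also have "\<dots> \<le> lam k * B\<^sup>2" using Mu l0 by (rule mult_left_mono)
    also have "\<dots> = (B * sqrt (lam k))\<^sup>2" using l0 by (simp add: power_mult_distrib)
    finally show "(\<Sum>i<n. (\<Sum>j<m. A $$ (i,j) * u k j) * (\<Sum>j<m. M i j * u k j)) \<le> B * sqrt (lam k)"
      by (rule power2_le_imp_le) (use B l0 in simp)
  qed
  finally show ?thesis unfolding tn by (simp add: sum_distrib_left)
qed

section \<open>A Khintchine inequality for trace moments\<close>

text \<open>For \<open>a \<noteq> b\<close> this is \<open>E_ab + E_ba\<close>, the contribution of
  a single sample to the symmetric dilation.\<close>

definition sym_unit :: "nat \<Rightarrow> nat \<Rightarrow> nat \<Rightarrow> nat \<Rightarrow> real" where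
  "sym_unit a b x y = (if x = a \<and> y = b \<or> x = b \<and> y = a then 1 else 0)"

lemma sum_sym_unit:
  assumes "a < d" "b < d" "a \<noteq> b"
  shows "(\<Sum>x<d. \<Sum>y<d. sym_unit a b x y * f x y) = f a b + f b a"
proof -
  have "sym_unit a b x y * f x y = (if y = b then (if x = a then f x y else 0) else 0)
      + (if y = a then (if x = b then f x y else 0) else 0)" for x y
    using assms by (auto simp: sym_unit_def)
  then show ?thesis using assms by (simp add: sum.distrib)
qed

text \<open>The left side is the divided difference of the power N + 1. Each term is at most the
  N-th power of the larger absolute value; for even N this is bounded by a sum of powers without
  absolute values, which can later be read as traces.\<close>

lemma abs_sum_power_products_le:
  fixes x y :: real
  assumes N: "even N"
  shows "\<bar>\<Sum>i<Suc N. y ^ (Suc N - Suc i) * x ^ i\<bar> \<le> real (Suc N) * (x ^ N + y ^ N)"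
proof -
  have "\<bar>y ^ (Suc N - Suc i) * x ^ i\<bar> \<le> x ^ N + y ^ N" if "i < Suc N" for i
  proof -
    define M where "M = max \<bar>x\<bar> \<bar>y\<bar>"
    have "\<bar>x\<bar> \<le> M" "\<bar>y\<bar> \<le> M" by (auto simp: M_def)
    then have "\<bar>y ^ (Suc N - Suc i) * x ^ i\<bar> \<le> M ^ (N - i) * M ^ i"
      unfolding abs_mult power_abs diff_Suc_Suc by (intro mult_mono power_mono) auto
    also have "\<dots> = M ^ N" using that by (simp add: power_add[symmetric])
    also have "\<dots> \<le> x ^ N + y ^ N"
      unfolding M_def max_def using N zero_le_even_power[OF N, of x] zero_le_even_power[OF N, of y]
      by (auto simp: power_even_abs)
    finally show ?thesis .
  qed
  then have "(\<Sum>i<Suc N. \<bar>y ^ (Suc N - Suc i) * x ^ i\<bar>) \<le> (\<Sum>i<Suc N. x ^ N + y ^ N)"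
    by (intro sum_mono) auto
  then show ?thesis using sum_abs[of "\<lambda>i. y ^ (Suc N - Suc i) * x ^ i" "{..<Suc N}"] by simp
qed

text \<open>
  Divided differences in the two eigenbases: with \<open>G\<^sub>i\<^sub>j = \<langle>u\<^sub>i, v\<^sub>j\<rangle>\<close>, the matrix of \<open>X - Y\<close> has entries
  \<open>(\<lambda>\<^sub>i - \<mu>\<^sub>j) G\<^sub>i\<^sub>j\<close>, and that of the difference of the powers has \<open>(\<lambda>\<^sub>i^(N+1) - \<mu>\<^sub>j^(N+1)) G\<^sub>i\<^sub>j\<close>.
\<close>

lemma eigenbasis_power_diff:
  assumes eX: "eigenbasis d X u lam" and eY: "eigenbasis d Y v mu"
    and ab: "a < d" "b < d" "a \<noteq> b"
    and XY: "\<And>x y. x < d \<Longrightarrow> y < d \<Longrightarrow> X x y - Y x y = c * sym_unit a b x y"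
    and sX: "\<And>x y. x < d \<Longrightarrow> y < d \<Longrightarrow> X x y = X y x"
    and N: "even N"
  shows "\<bar>(\<Sum>k<d. lam k ^ Suc N * u k a * u k b) - (\<Sum>k<d. mu k ^ Suc N * v k a * v k b)\<bar>
    \<le> \<bar>c\<bar> * (3 / 2 * real (Suc N)) * ((\<Sum>k<d. lam k ^ N * (u k a)\<^sup>2) + (\<Sum>k<d. lam k ^ N * (u k b)\<^sup>2)
        + (\<Sum>k<d. mu k ^ N * (v k a)\<^sup>2) + (\<Sum>k<d. mu k ^ N * (v k b)\<^sup>2))"
proof -
  define G where "G i j = (\<Sum>x<d. u i x * v j x)" for i j
  define S where "S x y = (\<Sum>i<Suc N. y ^ (Suc N - Suc i) * x ^ i)" for x y :: real
  have G: "(lam i - mu j) * G i j = c * (u i a * v j b + u i b * v j a)" if ij: "i < d" "j < d" for i j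
  proof -
    have "lam i * G i j = (\<Sum>y<d. (\<Sum>x<d. X y x * u i x) * v j y)"
      unfolding G_def using eigenbasis_vec[OF eX ij(1)] by (simp add: sum_distrib_left mult.assoc)
    also have "\<dots> = (\<Sum>y<d. \<Sum>x<d. X x y * (u i x * v j y))"
      unfolding sum_distrib_right using sX by (intro sum.cong refl) auto
    also have "\<dots> = (\<Sum>x<d. \<Sum>y<d. X x y * (u i x * v j y))" by (rule sum.swap)
    finally have 1: "lam i * G i j = (\<Sum>x<d. \<Sum>y<d. X x y * (u i x * v j y))" .
    have "mu j * G i j = (\<Sum>x<d. u i x * (\<Sum>y<d. Y x y * v j y))"
      unfolding G_def using eigenbasis_vec[OF eY ij(2)] by (simp add: sum_distrib_left mult_ac)
    also have "\<dots> = (\<Sum>x<d. \<Sum>y<d. Y x y * (u i x * v j y))"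
      unfolding sum_distrib_left by (simp add: mult_ac)
    finally have "(lam i - mu j) * G i j = (\<Sum>x<d. \<Sum>y<d. (X x y - Y x y) * (u i x * v j y))"
      using 1 by (simp add: left_diff_distrib sum_subtractf)
    also have "\<dots> = (\<Sum>x<d. \<Sum>y<d. sym_unit a b x y * (c * (u i x * v j y)))"
      using XY by (intro sum.cong refl) auto
    also have "\<dots> = c * (u i a * v j b + u i b * v j a)"
      unfolding sum_sym_unit[OF ab] by (simp add: algebra_simps)
    finally show ?thesis .
  qed
  \<comment> \<open>Inserting the other eigenbasis, \<open>v\<close> here and \<open>u\<close> in
    the next step, writes both powers as double sums with the common factor
    \<open>u i a * v j b * G i j\<close>, so that they can be subtracted term by term.\<close>
  have 1: "(\<Sum>k<d. lam k ^ Suc N * u k a * u k b) = (\<Sum>i<d. \<Sum>j<d. u i a * v j b * (lam i ^ Suc N * G i j))"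
  proof (rule sum.cong[OF refl])
    fix i
    have "u i b = (\<Sum>j<d. (\<Sum>x<d. v j x * u i x) * v j b)" by (rule eigenbasis_expand[OF eY ab(2)])
    also have "\<dots> = (\<Sum>j<d. G i j * v j b)" by (simp add: G_def mult.commute)
    finally have *: "u i b = (\<Sum>j<d. G i j * v j b)" .
    show "lam i ^ Suc N * u i a * u i b = (\<Sum>j<d. u i a * v j b * (lam i ^ Suc N * G i j))"
      by (subst *) (simp add: sum_distrib_left mult_ac)
  qed
  have 2: "(\<Sum>k<d. mu k ^ Suc N * v k a * v k b) = (\<Sum>i<d. \<Sum>j<d. u i a * v j b * (mu j ^ Suc N * G i j))"
  proof (subst sum.swap, rule sum.cong[OF refl])
    fix j
    have "v j a = (\<Sum>i<d. (\<Sum>x<d. u i x * v j x) * u i a)" by (rule eigenbasis_expand[OF eX ab(1)])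
    also have "\<dots> = (\<Sum>i<d. G i j * u i a)" by (simp add: G_def)
    finally have *: "v j a = (\<Sum>i<d. G i j * u i a)" .
    show "mu j ^ Suc N * v j a * v j b = (\<Sum>i<d. u i a * v j b * (mu j ^ Suc N * G i j))"
      by (subst *) (simp add: sum_distrib_left mult_ac)
  qed
  let ?D = "(\<Sum>k<d. lam k ^ Suc N * u k a * u k b) - (\<Sum>k<d. mu k ^ Suc N * v k a * v k b)"
  have "?D = (\<Sum>i<d. \<Sum>j<d. u i a * v j b * ((lam i ^ Suc N - mu j ^ Suc N) * G i j))"
    unfolding 1 2 by (simp add: sum_subtractf left_diff_distrib right_diff_distrib del: power_Suc)
  also have "\<dots> = (\<Sum>i<d. \<Sum>j<d. u i a * v j b * (S (lam i) (mu j) * (c * (u i a * v j b + u i b * v j a))))"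
  proof (intro sum.cong refl)
    fix i j assume "i \<in> {..<d}" "j \<in> {..<d}"
    then have "(lam i - mu j) * G i j = c * (u i a * v j b + u i b * v j a)" using G by simp
    then have "(lam i ^ Suc N - mu j ^ Suc N) * G i j = S (lam i) (mu j) * (c * (u i a * v j b + u i b * v j a))"
      unfolding power_diff_sumr2 S_def[symmetric] by (metis mult.assoc mult.commute)
    then show "u i a * v j b * ((lam i ^ Suc N - mu j ^ Suc N) * G i j) =
      u i a * v j b * (S (lam i) (mu j) * (c * (u i a * v j b + u i b * v j a)))" by simp
  qed
  finally have D: "?D = (\<Sum>i<d. \<Sum>j<d. u i a * v j b * (S (lam i) (mu j) * (c * (u i a * v j b + u i b * v j a))))" .
  have "\<bar>?D\<bar> \<le> (\<Sum>i<d. \<bar>\<Sum>j<d. u i a * v j b * (S (lam i) (mu j) * (c * (u i a * v j b + u i b * v j a)))\<bar>)"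
    unfolding D by (rule sum_abs)
  also have "\<dots> \<le> (\<Sum>i<d. \<Sum>j<d. \<bar>u i a * v j b * (S (lam i) (mu j) * (c * (u i a * v j b + u i b * v j a)))\<bar>)"
    by (intro sum_mono sum_abs)
  also have "\<dots> \<le> (\<Sum>i<d. \<Sum>j<d. (\<bar>c\<bar> * (3 / 2 * real (Suc N))) *
      ((lam i ^ N + mu j ^ N) * ((u i a)\<^sup>2 * (v j b)\<^sup>2 + (u i b)\<^sup>2 * (v j a)\<^sup>2)))"
  proof (intro sum_mono)
    fix i j
    let ?p = "u i a * v j b" and ?q = "u i b * v j a"
    \<comment> \<open>The mixed product is absorbed by \<open>|p q| \<le> (p^2 + q^2) / 2\<close>;
      this is the origin of the factor 3/2.\<close>
    have "\<bar>?p * (?p + ?q)\<bar> \<le> 3 / 2 * (?p\<^sup>2 + ?q\<^sup>2)"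
    proof -
      have "0 \<le> (?p + ?q)\<^sup>2" "0 \<le> (?p - ?q)\<^sup>2" "0 \<le> ?p\<^sup>2" "0 \<le> ?q\<^sup>2" by auto
      then show ?thesis by (auto simp: abs_le_iff power2_eq_square algebra_simps)
    qed
    moreover have "\<bar>S (lam i) (mu j)\<bar> \<le> real (Suc N) * (lam i ^ N + mu j ^ N)"
      unfolding S_def by (rule abs_sum_power_products_le[OF N])
    ultimately have "\<bar>S (lam i) (mu j)\<bar> * \<bar>?p * (?p + ?q)\<bar> \<le>
       (real (Suc N) * (lam i ^ N + mu j ^ N)) * (3 / 2 * (?p\<^sup>2 + ?q\<^sup>2))"
      by (intro mult_mono) auto
    then have *: "\<bar>c\<bar> * (\<bar>S (lam i) (mu j)\<bar> * \<bar>?p * (?p + ?q)\<bar>) \<le>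
       \<bar>c\<bar> * ((real (Suc N) * (lam i ^ N + mu j ^ N)) * (3 / 2 * (?p\<^sup>2 + ?q\<^sup>2)))"
      by (rule mult_left_mono) simp
    have "\<bar>?p * (S (lam i) (mu j) * (c * (?p + ?q)))\<bar> = \<bar>c\<bar> * (\<bar>S (lam i) (mu j)\<bar> * \<bar>?p * (?p + ?q)\<bar>)"
      by (simp add: abs_mult mult_ac)
    also note *
    also have "\<bar>c\<bar> * ((real (Suc N) * (lam i ^ N + mu j ^ N)) * (3 / 2 * (?p\<^sup>2 + ?q\<^sup>2))) =
      (\<bar>c\<bar> * (3 / 2 * real (Suc N))) *
      ((lam i ^ N + mu j ^ N) * ((u i a)\<^sup>2 * (v j b)\<^sup>2 + (u i b)\<^sup>2 * (v j a)\<^sup>2))"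
      by (simp only: power_mult_distrib mult_ac)
    finally show "\<bar>?p * (S (lam i) (mu j) * (c * (?p + ?q)))\<bar> \<le> (\<bar>c\<bar> * (3 / 2 * real (Suc N))) *
      ((lam i ^ N + mu j ^ N) * ((u i a)\<^sup>2 * (v j b)\<^sup>2 + (u i b)\<^sup>2 * (v j a)\<^sup>2))" .
  qed
  also have "\<dots> = (\<bar>c\<bar> * (3 / 2 * real (Suc N))) * (\<Sum>i<d. \<Sum>j<d.
      (lam i ^ N + mu j ^ N) * ((u i a)\<^sup>2 * (v j b)\<^sup>2 + (u i b)\<^sup>2 * (v j a)\<^sup>2))"
    by (simp only: sum_distrib_left)
  also have "(\<Sum>i<d. \<Sum>j<d. (lam i ^ N + mu j ^ N) * ((u i a)\<^sup>2 * (v j b)\<^sup>2 + (u i b)\<^sup>2 * (v j a)\<^sup>2)) =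
     (\<Sum>k<d. lam k ^ N * (u k a)\<^sup>2) + (\<Sum>k<d. lam k ^ N * (u k b)\<^sup>2)
        + (\<Sum>k<d. mu k ^ N * (v k a)\<^sup>2) + (\<Sum>k<d. mu k ^ N * (v k b)\<^sup>2)"
  proof -
    have n: "(\<Sum>k<d. (u k a)\<^sup>2) = 1" "(\<Sum>k<d. (u k b)\<^sup>2) = 1" "(\<Sum>k<d. (v k a)\<^sup>2) = 1" "(\<Sum>k<d. (v k b)\<^sup>2) = 1"
      using eX eY ab by (auto simp: eigenbasis_def power2_eq_square)
    have "(\<Sum>i<d. \<Sum>j<d. (lam i ^ N + mu j ^ N) * ((u i a)\<^sup>2 * (v j b)\<^sup>2 + (u i b)\<^sup>2 * (v j a)\<^sup>2)) =
      (\<Sum>i<d. lam i ^ N * (u i a)\<^sup>2) * (\<Sum>j<d. (v j b)\<^sup>2) + (\<Sum>i<d. lam i ^ N * (u i b)\<^sup>2) * (\<Sum>j<d. (v j a)\<^sup>2)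
      + (\<Sum>i<d. (u i b)\<^sup>2) * (\<Sum>j<d. mu j ^ N * (v j a)\<^sup>2) + (\<Sum>i<d. (u i a)\<^sup>2) * (\<Sum>j<d. mu j ^ N * (v j b)\<^sup>2)"
      unfolding sum_product sum.distrib[symmetric] by (intro sum.cong refl) (simp add: algebra_simps)
    then show ?thesis unfolding n by simp
  qed
  finally show ?thesis .
qed

lemma eigenbasis_trace_power:
  assumes e: "eigenbasis d X u lam"
  shows "(\<Sum>x<d. \<Sum>k<d. lam k ^ N * (u k x)\<^sup>2) = (\<Sum>k<d. lam k ^ N)"
proof -
  have "(\<Sum>x<d. \<Sum>k<d. lam k ^ N * (u k x)\<^sup>2) = (\<Sum>k<d. lam k ^ N * (\<Sum>x<d. u k x * u k x))"
    by (subst sum.swap) (simp add: sum_distrib_left power2_eq_square)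
  also have "\<dots> = (\<Sum>k<d. lam k ^ N)" using e by (simp add: eigenbasis_def)
  finally show ?thesis .
qed

text \<open>Keeps one factor X of the trace of the power N + 1 explicit, so that it can be expanded
  as a sum over the samples.\<close>

lemma eigenbasis_trace_power_Suc:
  assumes e: "eigenbasis d X u lam"
  shows "(\<Sum>x<d. \<Sum>y<d. X x y * (\<Sum>k<d. lam k ^ N * u k x * u k y)) = (\<Sum>k<d. lam k ^ Suc N)"
proof -
  have "(\<Sum>x<d. \<Sum>y<d. X x y * (\<Sum>k<d. lam k ^ N * u k x * u k y)) =
    (\<Sum>x<d. \<Sum>y<d. \<Sum>k<d. lam k ^ N * u k x * (X x y * u k y))"
    unfolding sum_distrib_left by (simp add: mult_ac)
  also have "\<dots> = (\<Sum>x<d. \<Sum>k<d. \<Sum>y<d. lam k ^ N * u k x * (X x y * u k y))"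
    by (intro sum.cong refl sum.swap)
  also have "\<dots> = (\<Sum>x<d. \<Sum>k<d. lam k ^ Suc N * (u k x)\<^sup>2)"
    unfolding sum_distrib_left[symmetric] using eigenbasis_vec[OF e]
    by (intro sum.cong refl) (simp add: power2_eq_square mult_ac)
  also have "\<dots> = (\<Sum>k<d. lam k ^ Suc N)" by (rule eigenbasis_trace_power[OF e])
  finally show ?thesis .
qed

section \<open>Averages over sign patterns and the moment recursion\<close>

definition sign_lists :: "nat \<Rightarrow> real list set" where
  "sign_lists s = {e. length e = s \<and> set e \<subseteq> {1, -1}}"

lemma finite_sign_lists [simp]: "finite (sign_lists s)"
  unfolding sign_lists_def using finite_lists_length_eq[of "{1, -1 :: real}" s]
  by (rule rev_finite_subset) auto

lemma sign_lists_0: "sign_lists 0 = {[]}"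
  by (auto simp: sign_lists_def)

text \<open>The sign is peeled off at the head because \<open>replicate_pmf\<close> prepends the new
  draw; signs and samples then recurse together.\<close>

lemma sum_sign_lists_Suc:
  "(\<Sum>e\<in>sign_lists (Suc s). f e) = (\<Sum>e\<in>sign_lists s. f (1 # e) + (f (-1 # e) :: real))"
proof -
  have "sign_lists (Suc s) = (#) 1 ` sign_lists s \<union> (#) (-1) ` sign_lists s"
    by (auto simp: sign_lists_def length_Suc_conv)
  then have "(\<Sum>e\<in>sign_lists (Suc s). f e) = (\<Sum>e\<in>(#) 1 ` sign_lists s. f e) + (\<Sum>e\<in>(#) (-1) ` sign_lists s. f e)"
    by (simp only:) (rule sum.union_disjoint, auto)
  also have "\<dots> = (\<Sum>e\<in>sign_lists s. f (1 # e)) + (\<Sum>e\<in>sign_lists s. f (-1 # e))"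
    by (simp add: sum.reindex)
  finally show ?thesis by (simp add: sum.distrib)
qed

lemma card_sign_lists: "real (card (sign_lists s)) = 2 ^ s"
proof -
  have "(\<Sum>e\<in>sign_lists s. 1::real) = 2 ^ s"
    by (induction s) (simp_all only: sign_lists_0 sum_sign_lists_Suc sum.distrib, simp_all)
  then show ?thesis by simp
qed

lemma sign_lists_nth:
  assumes "e \<in> sign_lists s" "t < s"
  shows "e ! t \<in> {1, -1}"
proof -
  have "e ! t \<in> set e" "set e \<subseteq> {1, -1}" using assms by (auto simp: sign_lists_def)
  then show ?thesis by blast
qed

lemma sign_lists_flip:
  assumes "e \<in> sign_lists s" "t < s"
  shows "e[t := - e ! t] \<in> sign_lists s"
proof -
  have "set (e[t := - e ! t]) \<subseteq> insert (- e ! t) (set e)" by (rule set_update_subset_insert)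
  moreover have "- e ! t \<in> {1, -1}" using sign_lists_nth[OF assms] by auto
  ultimately have "set (e[t := - e ! t]) \<subseteq> {1, -1}"
    using assms(1) unfolding sign_lists_def by blast
  then show ?thesis using assms(1) by (simp add: sign_lists_def)
qed

text \<open>Flipping is an involution of the sign patterns; this stands in for conditioning on all
  signs except the t-th.\<close>

lemma sum_sign_lists_flip:
  assumes "t < s"
  shows "(\<Sum>e\<in>sign_lists s. f (e[t := - e ! t])) = (\<Sum>e\<in>sign_lists s. (f e :: real))"
proof (rule sum.reindex_bij_witness[of _ "\<lambda>e. e[t := - e ! t]" "\<lambda>e. e[t := - e ! t]"])
  show "e[t := - e ! t] \<in> sign_lists s" if "e \<in> sign_lists s" for e
    using sign_lists_flip[OF that assms] .
  then show "e[t := - e ! t] \<in> sign_lists s" if "e \<in> sign_lists s" for e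
    using that .
qed (use assms in \<open>auto simp: sign_lists_def\<close>)

text \<open>
  Write one factor of the trace power as \<open>X = \<Sum>\<^sub>t \<epsilon>\<^sub>t A\<^sub>t\<close> and average each term over flipping \<open>\<epsilon>\<^sub>t\<close>, which leaves
  differences of powers at two sign patterns that differ in one position.
\<close>

lemma khintchine_step:
  fixes a b :: "nat \<Rightarrow> nat" and w :: "nat \<Rightarrow> real" and s :: nat
  defines "X \<equiv> \<lambda>e x y. \<Sum>t<s. e ! t * w t * sym_unit (a t) (b t) x y"
  assumes ab: "\<And>t. t < s \<Longrightarrow> a t < d" "\<And>t. t < s \<Longrightarrow> b t < d" "\<And>t. t < s \<Longrightarrow> a t \<noteq> b t"
    and eb: "\<And>e. e \<in> sign_lists s \<Longrightarrow> eigenbasis d (X e) (u e) (lam e)"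
    and V: "\<And>x. x < d \<Longrightarrow> (\<Sum>t<s. (w t)\<^sup>2 * (of_bool (a t = x) + of_bool (b t = x))) \<le> V"
    and N: "even N"
  shows "(\<Sum>e\<in>sign_lists s. \<Sum>k<d. lam e k ^ Suc (Suc N))
     \<le> 6 * real (Suc N) * V * (\<Sum>e\<in>sign_lists s. \<Sum>k<d. lam e k ^ N)"
proof -
  let ?SL = "sign_lists s"
  define P where "P e x = (\<Sum>k<d. lam e k ^ N * (u e k x)\<^sup>2)" for e x
  define R where "R e x y = (\<Sum>k<d. lam e k ^ Suc N * u e k x * u e k y)" for e x y
  have P0: "P e x \<ge> 0" for e x
    unfolding P_def using N by (intro sum_nonneg mult_nonneg_nonneg zero_le_even_power) auto
  \<comment> \<open>The factor 2 counts the two nonzero entries of \<open>sym_unit\<close>, which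
    contribute equally because \<open>R e\<close> is symmetric.\<close>
  have 1: "(\<Sum>k<d. lam e k ^ Suc (Suc N)) = (\<Sum>t<s. 2 * w t * (e ! t * R e (a t) (b t)))" if e: "e \<in> ?SL" for e
  proof -
    have "(\<Sum>k<d. lam e k ^ Suc (Suc N)) = (\<Sum>x<d. \<Sum>y<d. X e x y * R e x y)"
      unfolding R_def using eigenbasis_trace_power_Suc[OF eb[OF e], of "Suc N"] by simp
    also have "\<dots> = (\<Sum>x<d. \<Sum>y<d. \<Sum>t<s. sym_unit (a t) (b t) x y * (e ! t * w t * R e x y))"
      unfolding X_def sum_distrib_right by (simp add: mult_ac)
    also have "\<dots> = (\<Sum>t<s. \<Sum>x<d. \<Sum>y<d. sym_unit (a t) (b t) x y * (e ! t * w t * R e x y))"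
      by (subst (2) sum.swap, subst sum.swap) (rule refl)
    also have "\<dots> = (\<Sum>t<s. 2 * w t * (e ! t * R e (a t) (b t)))"
    proof (intro sum.cong refl)
      fix t assume "t \<in> {..<s}"
      then have "(\<Sum>x<d. \<Sum>y<d. sym_unit (a t) (b t) x y * (e ! t * w t * R e x y)) =
        e ! t * w t * R e (a t) (b t) + e ! t * w t * R e (b t) (a t)"
        using ab by (intro sum_sym_unit) auto
      moreover have "R e (b t) (a t) = R e (a t) (b t)" by (simp add: R_def mult_ac)
      ultimately show "(\<Sum>x<d. \<Sum>y<d. sym_unit (a t) (b t) x y * (e ! t * w t * R e x y)) =
        2 * w t * (e ! t * R e (a t) (b t))" by simp
    qed
    finally show ?thesis .
  qed
  have 2: "\<bar>\<Sum>e\<in>?SL. e ! t * R e (a t) (b t)\<bar> \<le> 3 * \<bar>w t\<bar> * real (Suc N) * (\<Sum>e\<in>?SL. P e (a t) + P e (b t))"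
    if t: "t < s" for t
  proof -
    let ?f = "\<lambda>e::real list. e[t := - e ! t]"
    let ?Q = "\<lambda>e. P e (a t) + P e (b t)"
    have "(\<Sum>e\<in>?SL. e ! t * R e (a t) (b t)) = (\<Sum>e\<in>?SL. ?f e ! t * R (?f e) (a t) (b t))"
      using sum_sign_lists_flip[OF t, of "\<lambda>e. e ! t * R e (a t) (b t)"] by simp
    also have "\<dots> = (\<Sum>e\<in>?SL. - (e ! t * R (?f e) (a t) (b t)))"
      using t by (intro sum.cong) (auto simp: sign_lists_def)
    finally have "2 * (\<Sum>e\<in>?SL. e ! t * R e (a t) (b t)) = (\<Sum>e\<in>?SL. e ! t * (R e (a t) (b t) - R (?f e) (a t) (b t)))"
      by (simp add: sum_negf right_diff_distrib sum_subtractf)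
    then have "2 * \<bar>\<Sum>e\<in>?SL. e ! t * R e (a t) (b t)\<bar> = \<bar>\<Sum>e\<in>?SL. e ! t * (R e (a t) (b t) - R (?f e) (a t) (b t))\<bar>"
      by (metis abs_mult abs_numeral)
    also have "\<dots> \<le> (\<Sum>e\<in>?SL. \<bar>e ! t * (R e (a t) (b t) - R (?f e) (a t) (b t))\<bar>)" by (rule sum_abs)
    also have "\<dots> \<le> (\<Sum>e\<in>?SL. 3 * \<bar>w t\<bar> * real (Suc N) * (?Q e + ?Q (?f e)))"
    proof (rule sum_mono)
      fix e assume e: "e \<in> ?SL"
      have et: "e ! t \<in> {1, -1}" using sign_lists_nth[OF e t] .
      have fe: "?f e \<in> ?SL" by (rule sign_lists_flip[OF e t])
      have len: "length e = s" using e by (simp add: sign_lists_def)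
      have dX: "X e x y - X (?f e) x y = (2 * e ! t * w t) * sym_unit (a t) (b t) x y" for x y
      proof -
        have "X e x y - X (?f e) x y = (\<Sum>r<s. (e ! r - ?f e ! r) * w r * sym_unit (a r) (b r) x y)"
          by (simp add: X_def sum_subtractf left_diff_distrib)
        also have "\<dots> = (\<Sum>r<s. if r = t then (2 * e ! t * w t) * sym_unit (a t) (b t) x y else 0)"
          using len t by (intro sum.cong) auto
        finally show ?thesis using t by simp
      qed
      have "\<bar>R e (a t) (b t) - R (?f e) (a t) (b t)\<bar> \<le>
        \<bar>2 * e ! t * w t\<bar> * (3 / 2 * real (Suc N)) * (P e (a t) + P e (b t) + P (?f e) (a t) + P (?f e) (b t))"
        unfolding R_def P_def
        by (rule eigenbasis_power_diff[OF eb[OF e] eb[OF fe] ab[OF t] dX _ N])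
          (auto simp: X_def sym_unit_def intro!: sum.cong)
      moreover have "\<bar>2 * e ! t * w t\<bar> = 2 * \<bar>w t\<bar>"
        "\<bar>e ! t * (R e (a t) (b t) - R (?f e) (a t) (b t))\<bar> = \<bar>R e (a t) (b t) - R (?f e) (a t) (b t)\<bar>"
        using et by (auto simp: abs_mult)
      ultimately have "\<bar>e ! t * (R e (a t) (b t) - R (?f e) (a t) (b t))\<bar> \<le>
        2 * \<bar>w t\<bar> * (3 / 2 * real (Suc N)) * (P e (a t) + P e (b t) + P (?f e) (a t) + P (?f e) (b t))"
        by simp
      also have "\<dots> = 3 * \<bar>w t\<bar> * real (Suc N) * (?Q e + ?Q (?f e))"
        by (simp add: field_simps)
      finally show "\<bar>e ! t * (R e (a t) (b t) - R (?f e) (a t) (b t))\<bar> \<le>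
        3 * \<bar>w t\<bar> * real (Suc N) * (?Q e + ?Q (?f e))" .
    qed
    also have "\<dots> = 3 * \<bar>w t\<bar> * real (Suc N) * ((\<Sum>e\<in>?SL. ?Q e) + (\<Sum>e\<in>?SL. ?Q (?f e)))"
      by (simp only: sum_distrib_left[symmetric] sum.distrib)
    also have "(\<Sum>e\<in>?SL. ?Q (?f e)) = (\<Sum>e\<in>?SL. ?Q e)" by (rule sum_sign_lists_flip[OF t])
    also have "c * (Z + Z) = 2 * (c * Z)" for c Z :: real by simp
    finally show ?thesis by (simp only: mult_le_cancel_left_pos zero_less_numeral)
  qed
  have "(\<Sum>e\<in>?SL. \<Sum>k<d. lam e k ^ Suc (Suc N)) = (\<Sum>t<s. 2 * w t * (\<Sum>e\<in>?SL. e ! t * R e (a t) (b t)))"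
    using 1 by (simp add: sum.swap[of _ _ ?SL] sum_distrib_left del: power_Suc)
  also have "\<dots> \<le> (\<Sum>t<s. 2 * \<bar>w t\<bar> * (3 * \<bar>w t\<bar> * real (Suc N) * (\<Sum>e\<in>?SL. P e (a t) + P e (b t))))"
  proof (rule sum_mono)
    fix t assume "t \<in> {..<s}"
    then have *: "\<bar>\<Sum>e\<in>?SL. e ! t * R e (a t) (b t)\<bar> \<le> 3 * \<bar>w t\<bar> * real (Suc N) * (\<Sum>e\<in>?SL. P e (a t) + P e (b t))"
      using 2 by simp
    have "2 * w t * (\<Sum>e\<in>?SL. e ! t * R e (a t) (b t)) \<le> \<bar>2 * w t * (\<Sum>e\<in>?SL. e ! t * R e (a t) (b t))\<bar>" by simp
    also have "\<dots> = 2 * \<bar>w t\<bar> * \<bar>\<Sum>e\<in>?SL. e ! t * R e (a t) (b t)\<bar>" by (simp add: abs_mult)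
    also have "\<dots> \<le> 2 * \<bar>w t\<bar> * (3 * \<bar>w t\<bar> * real (Suc N) * (\<Sum>e\<in>?SL. P e (a t) + P e (b t)))"
      by (rule mult_left_mono[OF *]) simp
    finally show "2 * w t * (\<Sum>e\<in>?SL. e ! t * R e (a t) (b t)) \<le>
      2 * \<bar>w t\<bar> * (3 * \<bar>w t\<bar> * real (Suc N) * (\<Sum>e\<in>?SL. P e (a t) + P e (b t)))" .
  qed
  also have "\<dots> = 6 * real (Suc N) * (\<Sum>e\<in>?SL. \<Sum>t<s. (w t)\<^sup>2 * (P e (a t) + P e (b t)))"
  proof -
    have *: "2 * x * (3 * x * c * Z) = 6 * c * (x\<^sup>2 * Z)" for x c Z :: real
      by (simp add: power2_eq_square)
    have "2 * \<bar>w t\<bar> * (3 * \<bar>w t\<bar> * real (Suc N) * Z) = 6 * real (Suc N) * ((w t)\<^sup>2 * Z)" for t Z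
    proof -
      have "2 * \<bar>w t\<bar> * (3 * \<bar>w t\<bar> * real (Suc N) * Z) = 6 * real (Suc N) * (\<bar>w t\<bar>\<^sup>2 * Z)"
        by (rule *)
      then show ?thesis by simp
    qed
    then show ?thesis by (simp only: sum_distrib_left sum.swap[of _ _ ?SL])
  qed
  also have "\<dots> \<le> 6 * real (Suc N) * (\<Sum>e\<in>?SL. V * (\<Sum>k<d. lam e k ^ N))"
  proof (intro mult_left_mono sum_mono)
    fix e assume e: "e \<in> ?SL"
    \<comment> \<open>Regrouping by index instead of by sample: the squared weights that touch x add
      up to at most V, while \<open>P e x\<close> adds up over x to the trace of the N-th
      power.\<close>
    have "(\<Sum>t<s. (w t)\<^sup>2 * (P e (a t) + P e (b t))) =
      (\<Sum>t<s. \<Sum>x<d. P e x * ((w t)\<^sup>2 * (of_bool (a t = x) + of_bool (b t = x))))"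
    proof (rule sum.cong[OF refl])
      fix t assume t: "t \<in> {..<s}"
      have "(\<Sum>x<d. P e x * ((w t)\<^sup>2 * (of_bool (a t = x) + of_bool (b t = x)))) =
        (\<Sum>x<d. (if x = a t then P e x * (w t)\<^sup>2 else 0) + (if x = b t then P e x * (w t)\<^sup>2 else 0))"
        by (intro sum.cong) (auto simp: of_bool_def)
      also have "\<dots> = (w t)\<^sup>2 * (P e (a t) + P e (b t))"
        using ab(1,2)[of t] t by (simp add: sum.distrib algebra_simps)
      finally show "(w t)\<^sup>2 * (P e (a t) + P e (b t)) =
         (\<Sum>x<d. P e x * ((w t)\<^sup>2 * (of_bool (a t = x) + of_bool (b t = x))))" by simp
    qed
    also have "\<dots> = (\<Sum>x<d. P e x * (\<Sum>t<s. (w t)\<^sup>2 * (of_bool (a t = x) + of_bool (b t = x))))"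
      by (subst sum.swap) (simp only: sum_distrib_left)
    also have "\<dots> \<le> (\<Sum>x<d. P e x * V)"
      using V P0 by (intro sum_mono mult_left_mono) auto
    also have "\<dots> = V * (\<Sum>k<d. lam e k ^ N)"
      using eigenbasis_trace_power[OF eb[OF e], of N] by (simp add: P_def sum_distrib_right[symmetric])
    finally show "(\<Sum>t<s. (w t)\<^sup>2 * (P e (a t) + P e (b t))) \<le> V * (\<Sum>k<d. lam e k ^ N)" .
  qed simp
  also have "\<dots> = 6 * real (Suc N) * V * (\<Sum>e\<in>?SL. \<Sum>k<d. lam e k ^ N)"
    by (simp only: sum_distrib_left[symmetric] mult.assoc)
  finally show ?thesis .
qed

text \<open>Each step lowers the exponent by two at the price \<open>6 * (2 * k + 1) * V\<close>, at
  most \<open>12 * p * V\<close> as long as k < p. Keeping p fixed while k grows makes this price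
  uniform. The recursion ends at the trace of the identity, summed over all sign patterns.\<close>

lemma khintchine:
  fixes a b :: "nat \<Rightarrow> nat" and w :: "nat \<Rightarrow> real" and s :: nat
  defines "X \<equiv> \<lambda>e x y. \<Sum>t<s. e ! t * w t * sym_unit (a t) (b t) x y"
  assumes ab: "\<And>t. t < s \<Longrightarrow> a t < d" "\<And>t. t < s \<Longrightarrow> b t < d" "\<And>t. t < s \<Longrightarrow> a t \<noteq> b t"
    and eb: "\<And>e. e \<in> sign_lists s \<Longrightarrow> eigenbasis d (X e) (u e) (lam e)"
    and V: "\<And>x. x < d \<Longrightarrow> (\<Sum>t<s. (w t)\<^sup>2 * (of_bool (a t = x) + of_bool (b t = x))) \<le> V"
    and V0: "V \<ge> 0" and k: "k \<le> p"
  shows "(\<Sum>e\<in>sign_lists s. \<Sum>i<d. lam e i ^ (2 * k)) \<le> (12 * real p * V) ^ k * (real d * 2 ^ s)"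
  using k
proof (induction k)
  case 0
  then show ?case by (simp add: card_sign_lists mult.commute)
next
  case (Suc k)
  have "(\<Sum>e\<in>sign_lists s. \<Sum>i<d. lam e i ^ (2 * Suc k)) \<le>
    6 * real (Suc (2 * k)) * V * (\<Sum>e\<in>sign_lists s. \<Sum>i<d. lam e i ^ (2 * k))"
    using khintchine_step[OF ab eb[unfolded X_def] V, of "2 * k"] by simp
  also have "\<dots> \<le> (12 * real p * V) * (\<Sum>e\<in>sign_lists s. \<Sum>i<d. lam e i ^ (2 * k))"
    using Suc.prems V0 by (intro mult_right_mono sum_nonneg zero_le_even_power) auto
  also have "\<dots> \<le> (12 * real p * V) * ((12 * real p * V) ^ k * (real d * 2 ^ s))"
    using Suc V0 by (intro mult_left_mono) auto
  finally show ?case by (simp add: mult.assoc)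
qed

section \<open>From trace moments to the trace-norm ball\<close>

lemma eigenbasis_op_norm:
  assumes e: "eigenbasis d X u lam"
    and s: "\<And>x y. x < d \<Longrightarrow> y < d \<Longrightarrow> X x y = X y x"
    and L: "\<And>k. k < d \<Longrightarrow> \<bar>lam k\<bar> \<le> L"
  shows "(\<Sum>x<d. (\<Sum>y<d. X x y * v y)\<^sup>2) \<le> L\<^sup>2 * (\<Sum>y<d. (v y)\<^sup>2)"
proof -
  have 1: "(\<Sum>x<d. u k x * (\<Sum>y<d. X x y * v y)) = lam k * (\<Sum>y<d. u k y * v y)" if k: "k < d" for k
  proof -
    have "(\<Sum>x<d. u k x * (\<Sum>y<d. X x y * v y)) = (\<Sum>x<d. \<Sum>y<d. (X y x * u k x) * v y)"
      unfolding sum_distrib_left using s by (intro sum.cong refl) auto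
    also have "\<dots> = (\<Sum>y<d. (\<Sum>x<d. X y x * u k x) * v y)"
      by (subst sum.swap) (simp only: sum_distrib_right)
    also have "\<dots> = lam k * (\<Sum>y<d. u k y * v y)"
      using eigenbasis_vec[OF e k] by (simp add: sum_distrib_left mult_ac)
    finally show ?thesis .
  qed
  have "(\<Sum>x<d. (\<Sum>y<d. X x y * v y)\<^sup>2) = (\<Sum>k<d. (lam k * (\<Sum>y<d. u k y * v y))\<^sup>2)"
    using eigenbasis_parseval[OF e, of "\<lambda>x. \<Sum>y<d. X x y * v y" "\<lambda>x. \<Sum>y<d. X x y * v y"] 1
    by (simp add: power2_eq_square)
  also have "\<dots> \<le> (\<Sum>k<d. L\<^sup>2 * (\<Sum>y<d. u k y * v y)\<^sup>2)"
    unfolding power_mult_distrib using power_mono[OF L abs_ge_zero, of _ 2]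
    by (intro sum_mono mult_right_mono) auto
  also have "\<dots> = L\<^sup>2 * (\<Sum>y<d. (v y)\<^sup>2)"
    unfolding sum_distrib_left[symmetric] using eigenbasis_parseval[OF e, of v v]
    by (simp add: power2_eq_square)
  finally show ?thesis .
qed

text \<open>Beyond B the ratio \<open>|x| / B\<close> exceeds 1 and is dominated by its power 2p.
  The bound is linear in the moment, so it can be averaged over the signs directly, without roots of
  moments or Jensen's inequality.\<close>

lemma abs_le_moment:
  fixes x B :: real
  assumes B: "B > 0" and p: "p \<ge> 1"
  shows "\<bar>x\<bar> \<le> B + B * (x ^ (2 * p) / B ^ (2 * p))"
proof (cases "\<bar>x\<bar> \<le> B")
  case True
  moreover have "0 \<le> B * (x ^ (2 * p) / B ^ (2 * p))"
    using B by (intro mult_nonneg_nonneg divide_nonneg_nonneg zero_le_even_power) auto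
  ultimately show ?thesis by linarith
next
  case False
  then have 1: "1 \<le> \<bar>x\<bar> / B" using B by simp
  have "\<bar>x\<bar> / B \<le> (\<bar>x\<bar> / B) ^ (2 * p)" using power_increasing[of 1 "2 * p", OF _ 1] p by simp
  also have "\<dots> = x ^ (2 * p) / B ^ (2 * p)" by (simp add: power_divide power_even_abs)
  finally have "\<bar>x\<bar> \<le> B * (x ^ (2 * p) / B ^ (2 * p))" using B by (simp add: field_simps)
  then show ?thesis using B by linarith
qed

lemma sum_dilation:
  fixes f :: "nat \<Rightarrow> real"
  shows "(\<Sum>x<n + m. f x) = (\<Sum>i<n. f i) + (\<Sum>j<m. f (n + j))"
  by (induction m) auto

text \<open>
  The rectangular sign sum is handled through its symmetric dilation of size \<open>n + m\<close>, in which column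
  \<open>j\<close> becomes index \<open>n + j\<close>. Letting \<open>A\<close> depend on the signs replaces a supremum over the ball.
\<close>

lemma rademacher_trace_norm_ball:
  fixes S :: "(nat \<times> nat) list" and wt :: "nat \<times> nat \<Rightarrow> real" and A :: "real list \<Rightarrow> real mat"
  assumes s: "length S = s" and S: "set S \<subseteq> {..<n} \<times> {..<m}"
    and Vr: "\<And>i. i < n \<Longrightarrow> (\<Sum>t<s. (wt (S ! t))\<^sup>2 * of_bool (fst (S ! t) = i)) \<le> V"
    and Vc: "\<And>j. j < m \<Longrightarrow> (\<Sum>t<s. (wt (S ! t))\<^sup>2 * of_bool (snd (S ! t) = j)) \<le> V"
    and V: "V > 0" and p: "p \<ge> 1" and np: "real (n + m) \<le> exp (real p)"
    and A: "\<And>e. e \<in> sign_lists s \<Longrightarrow> A e \<in> carrier_mat n m"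
           "\<And>e. e \<in> sign_lists s \<Longrightarrow> trace_norm (A e) \<le> \<rho>" and \<rho>: "\<rho> \<ge> 0"
  shows "(\<Sum>e\<in>sign_lists s. \<Sum>t<s. e ! t * (wt (S ! t) * A e $$ (S ! t)))
     \<le> 2 ^ s * (\<rho> * (2 * sqrt (exp 1 * (12 * real p * V))))"
proof -
  let ?SL = "sign_lists s"
  let ?d = "n + m"
  define a where "a t = fst (S ! t)" for t
  define b where "b t = n + snd (S ! t)" for t
  define w where "w t = wt (S ! t)" for t
  define X where "X e x y = (\<Sum>t<s. e ! t * w t * sym_unit (a t) (b t) x y)" for e :: "real list" and x y
  have mem: "fst (S ! t) < n" "snd (S ! t) < m" if "t < s" for t
  proof -
    have "S ! t \<in> {..<n} \<times> {..<m}" using that S s by (metis nth_mem subsetD)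
    then show "fst (S ! t) < n" "snd (S ! t) < m" by (auto simp: mem_Times_iff)
  qed
  have ab: "a t < ?d" "b t < ?d" "a t \<noteq> b t" if "t < s" for t
    using mem[OF that] by (auto simp: a_def b_def)
  have sX: "X e x y = X e y x" for e x y
    unfolding X_def sym_unit_def by (intro sum.cong) auto
  then have "\<forall>e. \<exists>u lam. eigenbasis ?d (X e) u lam" using eigenbasis_exists by blast
  then obtain u lam where eb: "\<And>e. eigenbasis ?d (X e) (u e) (lam e)" by metis
  \<comment> \<open>In the dilation, row indices lie below n and column indices do not, so for each
    x only one of the two indicators can be nonzero.\<close>
  have VV: "(\<Sum>t<s. (w t)\<^sup>2 * (of_bool (a t = x) + of_bool (b t = x))) \<le> V" if x: "x < ?d" for x
  proof (cases "x < n")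
    case True
    then have "(\<Sum>t<s. (w t)\<^sup>2 * (of_bool (a t = x) + of_bool (b t = x))) =
       (\<Sum>t<s. (wt (S ! t))\<^sup>2 * of_bool (fst (S ! t) = x))"
      by (intro sum.cong) (auto simp: w_def a_def b_def)
    then show ?thesis using Vr[OF True] by simp
  next
    case False
    then have "(\<Sum>t<s. (w t)\<^sup>2 * (of_bool (a t = x) + of_bool (b t = x))) =
       (\<Sum>t<s. (wt (S ! t))\<^sup>2 * of_bool (snd (S ! t) = x - n))"
      by (intro sum.cong) (auto simp: w_def a_def b_def dest: mem(1))
    then show ?thesis using Vc[of "x - n"] False x by simp
  qed
  \<comment> \<open>The factor e under the root gives \<open>B ^ (2 * p)\<close> a factor
    \<open>exp p\<close>, which absorbs the dimension \<open>n + m\<close> in the moment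
    bound.\<close>
  define B where "B = sqrt (exp 1 * (12 * real p * V))"
  have B: "B > 0" using V p by (simp add: B_def)
  have B2: "B ^ (2 * p) = exp (real p) * (12 * real p * V) ^ p"
    using V by (simp add: B_def power_mult power_mult_distrib exp_of_nat_mult[symmetric])
  \<comment> \<open>The sum of the moments over all eigenvalues replaces the largest one; its
    average over the signs is at most 2 B.\<close>
  define L where "L e = B + B * (\<Sum>k<?d. lam e k ^ (2 * p) / B ^ (2 * p))" for e
  have lamL: "\<bar>lam e k\<bar> \<le> L e" if "k < ?d" for e k
  proof -
    have "lam e k ^ (2 * p) / B ^ (2 * p) \<le> (\<Sum>k<?d. lam e k ^ (2 * p) / B ^ (2 * p))"
      using B that by (intro member_le_sum divide_nonneg_nonneg zero_le_even_power) auto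
    then have "B * (lam e k ^ (2 * p) / B ^ (2 * p)) \<le> B * (\<Sum>k<?d. lam e k ^ (2 * p) / B ^ (2 * p))"
      by (rule mult_left_mono) (use B in simp)
    then show ?thesis using abs_le_moment[OF B p, of "lam e k"] by (simp add: L_def)
  qed
  have L0: "L e \<ge> 0" for e
    unfolding L_def using B
    by (intro add_nonneg_nonneg mult_nonneg_nonneg sum_nonneg divide_nonneg_nonneg zero_le_even_power) auto
  have 1: "(\<Sum>t<s. e ! t * (wt (S ! t) * A e $$ (S ! t))) \<le> L e * \<rho>" if e: "e \<in> ?SL" for e
  proof -
    define M where "M i j = X e i (n + j)" for i j
    have Me: "M i j = (\<Sum>t<s. e ! t * w t * of_bool (S ! t = (i, j)))" if "i < n" for i j
      unfolding M_def X_def sym_unit_def using that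
      by (intro sum.cong) (auto simp: a_def b_def prod_eq_iff)
    have Mv: "(\<Sum>i<n. (\<Sum>j<m. M i j * v j)\<^sup>2) \<le> (L e)\<^sup>2 * (\<Sum>j<m. (v j)\<^sup>2)" for v
    proof -
      \<comment> \<open>\<open>M\<close> is the upper right block of the dilation: padding v with
        zeros and dropping the last m output coordinates transfers the operator norm bound to
        it.\<close>
      define v' where "v' x = (if x < n then 0 else v (x - n))" for x
      have "(\<Sum>i<n. (\<Sum>j<m. M i j * v j)\<^sup>2) = (\<Sum>i<n. (\<Sum>y<?d. X e i y * v' y)\<^sup>2)"
        unfolding sum_dilation by (simp add: v'_def M_def)
      also have "\<dots> \<le> (\<Sum>x<?d. (\<Sum>y<?d. X e x y * v' y)\<^sup>2)"
        by (rule sum_mono2) auto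
      also have "\<dots> \<le> (L e)\<^sup>2 * (\<Sum>y<?d. (v' y)\<^sup>2)"
        by (rule eigenbasis_op_norm[OF eb sX lamL])
      also have "(\<Sum>y<?d. (v' y)\<^sup>2) = (\<Sum>j<m. (v j)\<^sup>2)"
        unfolding sum_dilation by (simp add: v'_def)
      finally show ?thesis .
    qed
    have "(\<Sum>t<s. e ! t * (wt (S ! t) * A e $$ (S ! t))) =
      (\<Sum>t<s. \<Sum>i<n. \<Sum>j<m. A e $$ (i,j) * (e ! t * w t * of_bool (S ! t = (i, j))))"
    proof (rule sum.cong[OF refl])
      fix t assume "t \<in> {..<s}"
      then have t: "fst (S ! t) < n" "snd (S ! t) < m" using mem by auto
      have "(\<Sum>i<n. \<Sum>j<m. A e $$ (i,j) * (e ! t * w t * of_bool (S ! t = (i, j)))) =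
        (\<Sum>i<n. \<Sum>j<m. if j = snd (S ! t) then (if i = fst (S ! t) then A e $$ (i,j) * (e ! t * w t) else 0) else 0)"
        by (intro sum.cong refl) (auto simp: prod_eq_iff)
      also have "\<dots> = A e $$ (S ! t) * (e ! t * w t)" using t by simp
      finally show "e ! t * (wt (S ! t) * A e $$ (S ! t)) =
        (\<Sum>i<n. \<Sum>j<m. A e $$ (i,j) * (e ! t * w t * of_bool (S ! t = (i, j))))"
        by (simp add: w_def mult_ac)
    qed
    also have "\<dots> = (\<Sum>i<n. \<Sum>t<s. \<Sum>j<m. A e $$ (i,j) * (e ! t * w t * of_bool (S ! t = (i, j))))"
      by (rule sum.swap)
    also have "\<dots> = (\<Sum>i<n. \<Sum>j<m. \<Sum>t<s. A e $$ (i,j) * (e ! t * w t * of_bool (S ! t = (i, j))))"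
      by (intro sum.cong refl sum.swap)
    also have "\<dots> = (\<Sum>i<n. \<Sum>j<m. A e $$ (i,j) * M i j)"
      unfolding sum_distrib_left[symmetric] by (intro sum.cong refl) (simp only: Me lessThan_iff)
    also have "\<dots> \<le> L e * trace_norm (A e)"
      by (rule trace_norm_duality[OF A(1)[OF e] L0 Mv])
    also have "\<dots> \<le> L e * \<rho>" by (rule mult_left_mono[OF A(2)[OF e] L0])
    finally show ?thesis .
  qed
  have kh: "(\<Sum>e\<in>?SL. \<Sum>k<?d. lam e k ^ (2 * p)) \<le> (12 * real p * V) ^ p * (real ?d * 2 ^ s)"
    by (rule khintchine[of s a ?d b w u lam, OF ab _ VV _ order_refl, folded X_def])
      (use eb V in \<open>auto simp: X_def[abs_def]\<close>)
  have "(\<Sum>e\<in>?SL. L e) = B * 2 ^ s + B * ((\<Sum>e\<in>?SL. \<Sum>k<?d. lam e k ^ (2 * p)) / B ^ (2 * p))"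
    by (simp add: L_def sum.distrib card_sign_lists sum_distrib_left sum_divide_distrib)
  also have "\<dots> \<le> B * 2 ^ s + B * ((12 * real p * V) ^ p * (real ?d * 2 ^ s) / B ^ (2 * p))"
    using B kh by (intro add_left_mono mult_left_mono divide_right_mono) auto
  also have "(12 * real p * V) ^ p * (real ?d * 2 ^ s) / B ^ (2 * p) = real ?d / exp (real p) * 2 ^ s"
    unfolding B2 using V p by simp
  also have "B * 2 ^ s + B * (real ?d / exp (real p) * 2 ^ s) \<le> B * 2 ^ s + B * (1 * 2 ^ s)"
    using B np by (intro add_left_mono mult_left_mono mult_right_mono) auto
  finally have 2: "(\<Sum>e\<in>?SL. L e) \<le> 2 ^ s * (2 * B)" by (simp add: mult_ac)
  have "(\<Sum>e\<in>?SL. \<Sum>t<s. e ! t * (wt (S ! t) * A e $$ (S ! t))) \<le> (\<Sum>e\<in>?SL. L e) * \<rho>"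
    unfolding sum_distrib_right by (rule sum_mono[OF 1])
  also have "\<dots> \<le> 2 ^ s * (2 * B) * \<rho>" by (rule mult_right_mono[OF 2 \<rho>])
  finally show ?thesis by (simp add: B_def mult_ac)
qed

section \<open>Symmetrization and contraction\<close>

lemma expectation_finite_support:
  fixes f :: "'a \<Rightarrow> real"
  assumes "finite (set_pmf q)"
  shows "measure_pmf.expectation q f = (\<Sum>a\<in>set_pmf q. pmf q a * f a)"
  using integral_measure_pmf_real[OF assms, of q f] by (simp add: mult.commute)

lemma finite_set_replicate_pmf:
  assumes "finite (set_pmf p)"
  shows "finite (set_pmf (replicate_pmf s p))"
  unfolding set_replicate_pmf lists_eq_set using finite_lists_length_eq[OF assms] by simp

lemma expectation_replicate_pmf_Suc:
  fixes f :: "'a list \<Rightarrow> real"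
  assumes p: "finite (set_pmf p)"
  shows "measure_pmf.expectation (replicate_pmf (Suc s) p) f =
    (\<Sum>z\<in>set_pmf p. pmf p z * measure_pmf.expectation (replicate_pmf s p) (\<lambda>S. f (z # S)))"
proof -
  have eq: "replicate_pmf (Suc s) p = bind_pmf p (\<lambda>z. map_pmf ((#) z) (replicate_pmf s p))"
    by (simp add: map_pmf_def)
  have "measure_pmf.expectation (replicate_pmf (Suc s) p) f =
    (\<Sum>z\<in>set_pmf p. pmf p z *\<^sub>R measure_pmf.expectation (map_pmf ((#) z) (replicate_pmf s p)) f)"
    unfolding eq by (rule pmf_expectation_bind[OF p]) (use finite_set_replicate_pmf[OF p] in auto)
  then show ?thesis by simp
qed

lemma sum_pmf_finite_support:
  assumes "finite (set_pmf q)"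
  shows "(\<Sum>a\<in>set_pmf q. pmf q a) = 1"
  using expectation_finite_support[OF assms, of "\<lambda>_. 1"] by simp

lemma sum_pmf_affine:
  assumes "finite (set_pmf q)"
  shows "(\<Sum>z\<in>set_pmf q. pmf q z * (a + b * f z)) = a + b * (\<Sum>z\<in>set_pmf q. pmf q z * (f z :: real))"
proof -
  have "(\<Sum>z\<in>set_pmf q. pmf q z * (a + b * f z)) = (\<Sum>z\<in>set_pmf q. pmf q z * a + b * (pmf q z * f z))"
    by (simp add: algebra_simps)
  also have "\<dots> = (\<Sum>z\<in>set_pmf q. pmf q z) * a + b * (\<Sum>z\<in>set_pmf q. pmf q z * f z)"
    by (simp only: sum.distrib sum_distrib_right sum_distrib_left)
  finally show ?thesis by (simp add: sum_pmf_finite_support[OF assms])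
qed

lemma Max_image_attained:
  assumes "finite F" "F \<noteq> {}"
  shows "\<exists>x\<in>F. Max (f ` F) = f x"
proof -
  have "Max (f ` F) \<in> f ` F" using assms by (intro Max_in) auto
  then show ?thesis by blast
qed

text \<open>The contraction principle for one sign. Let x and y maximize the two terms on the left.
  The right side is tested at (x, y) or at (y, x), depending on the sign of
  \<open>u x - u y\<close>. Only differences of h enter, so h need not vanish where u does.\<close>

lemma contraction_step:
  fixes c h u :: "'x \<Rightarrow> real"
  assumes F: "finite F" "F \<noteq> {}"
    and lip: "\<And>x y. x \<in> F \<Longrightarrow> y \<in> F \<Longrightarrow> \<bar>h x - h y\<bar> \<le> l * \<bar>u x - u y\<bar>"
  shows "Max ((\<lambda>x. c x + h x) ` F) + Max ((\<lambda>x. c x - h x) ` F)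
    \<le> Max ((\<lambda>x. c x + l * u x) ` F) + Max ((\<lambda>x. c x - l * u x) ` F)"
proof -
  obtain x where x: "x \<in> F" "Max ((\<lambda>x. c x + h x) ` F) = c x + h x"
    using Max_image_attained[OF F] by blast
  obtain y where y: "y \<in> F" "Max ((\<lambda>x. c x - h x) ` F) = c y - h y"
    using Max_image_attained[OF F] by blast
  have "c z + l * u z \<le> Max ((\<lambda>x. c x + l * u x) ` F)" "c z - l * u z \<le> Max ((\<lambda>x. c x - l * u x) ` F)"
    if "z \<in> F" for z using F that by auto
  note mx = this(1)[OF x(1)] this(2)[OF x(1)] this(1)[OF y(1)] this(2)[OF y(1)]
  have "h x - h y \<le> l * \<bar>u x - u y\<bar>" using lip[OF x(1) y(1)] by linarith
  then have "h x - h y \<le> l * u x - l * u y \<or> h x - h y \<le> l * u y - l * u x"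
    by (cases "u x \<ge> u y") (auto simp: abs_if right_diff_distrib)
  then show ?thesis unfolding x(2) y(2) using mx by linarith
qed

text \<open>With an independent copy z', the quantity \<open>c + E h - h(z)\<close> is the mean over
  z' of \<open>(c + 2 h(z')) / 2 + (c - 2 h(z)) / 2\<close>. The maximum of a sum is at most the sum
  of the maxima, and z' has the law of z, so both signs appear with weight 1/2. This doubles the
  Lipschitz constant.\<close>

lemma symmetrization_step:
  fixes c :: "'x \<Rightarrow> real" and h u :: "'x \<Rightarrow> 'z \<Rightarrow> real"
  assumes p: "finite (set_pmf p)" and F: "finite F" "F \<noteq> {}"
    and lip: "\<And>x y z. x \<in> F \<Longrightarrow> y \<in> F \<Longrightarrow> z \<in> set_pmf p \<Longrightarrow> \<bar>h x z - h y z\<bar> \<le> l * \<bar>u x z - u y z\<bar>"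
  shows "(\<Sum>z\<in>set_pmf p. pmf p z * Max ((\<lambda>x. c x + (measure_pmf.expectation p (h x) - h x z)) ` F)) \<le>
    (\<Sum>z\<in>set_pmf p. pmf p z * (1 / 2 * (Max ((\<lambda>x. c x + 2 * l * u x z) ` F) + Max ((\<lambda>x. c x - 2 * l * u x z) ` F))))"
proof -
  let ?P = "set_pmf p"
  let ?A = "\<lambda>z. Max ((\<lambda>x. c x + 2 * h x z) ` F)" and ?B = "\<lambda>z. Max ((\<lambda>x. c x - 2 * h x z) ` F)"
  have 1: "Max ((\<lambda>x. c x + (measure_pmf.expectation p (h x) - h x z)) ` F) \<le> 1 / 2 * (\<Sum>z'\<in>?P. pmf p z' * ?A z') + 1 / 2 * ?B z"
    (is "Max ?im \<le> ?rhs") for z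
  proof -
    have "c x + (measure_pmf.expectation p (h x) - h x z) \<le> ?rhs" if x: "x \<in> F" for x
    proof -
      have a: "c x + 2 * h x z' \<le> ?A z'" "c x - 2 * h x z' \<le> ?B z'" for z' using F x by auto
      have "(\<Sum>z'\<in>?P. pmf p z' * (c x + 2 * h x z')) \<le> (\<Sum>z'\<in>?P. pmf p z' * ?A z')"
        by (intro sum_mono mult_left_mono a) auto
      moreover have "(\<Sum>z'\<in>?P. pmf p z' * (c x + 2 * h x z')) = c x + 2 * measure_pmf.expectation p (h x)"
        unfolding expectation_finite_support[OF p] by (rule sum_pmf_affine[OF p])
      ultimately show ?thesis using a(2)[of z] by linarith
    qed
    then show ?thesis using F by (simp add: Max_le_iff)
  qed
  have "(\<Sum>z\<in>?P. pmf p z * Max ((\<lambda>x. c x + (measure_pmf.expectation p (h x) - h x z)) ` F)) \<le>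
    (\<Sum>z\<in>?P. pmf p z * (1 / 2 * (\<Sum>z'\<in>?P. pmf p z' * ?A z') + 1 / 2 * ?B z))"
    by (intro sum_mono mult_left_mono 1) auto
  also have "\<dots> = (\<Sum>z\<in>?P. pmf p z * (1 / 2 * (?A z + ?B z)))"
  proof -
    have "(\<Sum>z\<in>?P. pmf p z * (1 / 2 * C + 1 / 2 * ?B z)) = 1 / 2 * C + 1 / 2 * (\<Sum>z\<in>?P. pmf p z * ?B z)" for C
      by (rule sum_pmf_affine[OF p])
    moreover have "(\<Sum>z\<in>?P. pmf p z * (1 / 2 * (?A z + ?B z))) = 1 / 2 * (\<Sum>z\<in>?P. pmf p z * ?A z) + 1 / 2 * (\<Sum>z\<in>?P. pmf p z * ?B z)"
      by (simp add: distrib_left sum.distrib add_divide_distrib sum_distrib_left sum_divide_distrib)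
    ultimately show ?thesis by simp
  qed
  also have "\<dots> \<le> (\<Sum>z\<in>?P. pmf p z * (1 / 2 * (Max ((\<lambda>x. c x + 2 * l * u x z) ` F) + Max ((\<lambda>x. c x - 2 * l * u x z) ` F))))"
  proof (intro sum_mono mult_left_mono)
    fix z assume z: "z \<in> ?P"
    show "?A z + ?B z \<le> Max ((\<lambda>x. c x + 2 * l * u x z) ` F) + Max ((\<lambda>x. c x - 2 * l * u x z) ` F)"
    proof (rule contraction_step[OF F])
      fix x y assume "x \<in> F" "y \<in> F"
      then have "\<bar>h x z - h y z\<bar> \<le> l * \<bar>u x z - u y z\<bar>" using lip z by blast
      moreover have "\<bar>2 * h x z - 2 * h y z\<bar> = 2 * \<bar>h x z - h y z\<bar>"
        by (simp only: abs_mult abs_numeral right_diff_distrib[symmetric])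
      ultimately show "\<bar>2 * h x z - 2 * h y z\<bar> \<le> 2 * l * \<bar>u x z - u y z\<bar>" by linarith
    qed
  qed auto
  finally show ?thesis .
qed

text \<open>
  Samples are replaced one at a time, so symmetrization and contraction happen in the same step; the
  offset \<open>c\<close> carries the other coordinates.
\<close>

lemma symmetrization_contraction:
  fixes c :: "'x \<Rightarrow> real" and h u :: "'x \<Rightarrow> 'z \<Rightarrow> real"
  assumes p: "finite (set_pmf p)" and F: "finite F" "F \<noteq> {}"
    and lip: "\<And>x y z. x \<in> F \<Longrightarrow> y \<in> F \<Longrightarrow> z \<in> set_pmf p \<Longrightarrow> \<bar>h x z - h y z\<bar> \<le> l * \<bar>u x z - u y z\<bar>"
  shows "measure_pmf.expectation (replicate_pmf s p)
      (\<lambda>S. Max ((\<lambda>x. c x + (\<Sum>z\<leftarrow>S. measure_pmf.expectation p (h x) - h x z)) ` F)) \<le>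
    measure_pmf.expectation (replicate_pmf s p)
      (\<lambda>S. 1 / 2 ^ s * (\<Sum>e\<in>sign_lists s. Max ((\<lambda>x. c x + 2 * l * (\<Sum>t<s. e ! t * u x (S ! t))) ` F)))"
proof (induction s arbitrary: c)
  case 0
  then show ?case by (simp add: sign_lists_0)
next
  case (Suc s)
  let ?P = "set_pmf p" and ?R = "set_pmf (replicate_pmf s p)"
  let ?E = "\<lambda>x. measure_pmf.expectation p (h x)"
  define U where "U e S x = 2 * l * (\<Sum>t<s. e ! t * u x (S ! t))" for e and S :: "'z list" and x
  note fR = finite_set_replicate_pmf[OF p, of s]
  have "measure_pmf.expectation (replicate_pmf (Suc s) p)
      (\<lambda>S. Max ((\<lambda>x. c x + (\<Sum>z\<leftarrow>S. ?E x - h x z)) ` F)) =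
    (\<Sum>z\<in>?P. pmf p z * measure_pmf.expectation (replicate_pmf s p)
      (\<lambda>S. Max ((\<lambda>x. (c x + (?E x - h x z)) + (\<Sum>z\<leftarrow>S. ?E x - h x z)) ` F)))"
    unfolding expectation_replicate_pmf_Suc[OF p] by (simp add: add.assoc)
  also have "\<dots> \<le> (\<Sum>z\<in>?P. pmf p z * measure_pmf.expectation (replicate_pmf s p)
      (\<lambda>S. 1 / 2 ^ s * (\<Sum>e\<in>sign_lists s. Max ((\<lambda>x. (c x + (?E x - h x z)) + U e S x) ` F))))"
    unfolding U_def by (intro sum_mono mult_left_mono Suc.IH) auto
  \<comment> \<open>The sum over the new draw z is moved innermost: with S and the signs held fixed,
    the one-sample step applies with offset \<open>c x + U e S x\<close>.\<close>
  also have "\<dots> = (\<Sum>S\<in>?R. pmf (replicate_pmf s p) S * (1 / 2 ^ s * (\<Sum>e\<in>sign_lists s.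
      (\<Sum>z\<in>?P. pmf p z * Max ((\<lambda>x. (c x + U e S x) + (?E x - h x z)) ` F)))))"
  proof -
    have "(\<Sum>z\<in>?P. pmf p z * (\<Sum>S\<in>?R. q S * (a * (\<Sum>e\<in>sign_lists s. M z S e)))) =
      (\<Sum>S\<in>?R. q S * (a * (\<Sum>e\<in>sign_lists s. \<Sum>z\<in>?P. pmf p z * M z S e)))" for q a and M :: "'z \<Rightarrow> 'z list \<Rightarrow> real list \<Rightarrow> real"
    proof -
      have "(\<Sum>z\<in>?P. pmf p z * (\<Sum>S\<in>?R. q S * (a * (\<Sum>e\<in>sign_lists s. M z S e)))) =
        (\<Sum>z\<in>?P. \<Sum>S\<in>?R. \<Sum>e\<in>sign_lists s. q S * (a * (pmf p z * M z S e)))"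
        by (simp add: sum_distrib_left mult_ac)
      also have "\<dots> = (\<Sum>S\<in>?R. \<Sum>z\<in>?P. \<Sum>e\<in>sign_lists s. q S * (a * (pmf p z * M z S e)))"
        by (rule sum.swap)
      also have "\<dots> = (\<Sum>S\<in>?R. \<Sum>e\<in>sign_lists s. \<Sum>z\<in>?P. q S * (a * (pmf p z * M z S e)))"
        by (intro sum.cong refl sum.swap)
      finally show ?thesis by (simp add: sum_distrib_left)
    qed
    then show ?thesis unfolding expectation_finite_support[OF fR] by (simp only: add_ac)
  qed
  also have "\<dots> \<le> (\<Sum>S\<in>?R. pmf (replicate_pmf s p) S * (1 / 2 ^ s * (\<Sum>e\<in>sign_lists s.
      (\<Sum>z\<in>?P. pmf p z * (1 / 2 * (Max ((\<lambda>x. (c x + U e S x) + 2 * l * u x z) ` F) + Max ((\<lambda>x. (c x + U e S x) - 2 * l * u x z) ` F)))))))"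
    by (intro sum_mono mult_left_mono symmetrization_step[OF p F lip]) auto
  also have "\<dots> = (\<Sum>z\<in>?P. pmf p z * measure_pmf.expectation (replicate_pmf s p) (\<lambda>S. 1 / 2 ^ Suc s * (\<Sum>e\<in>sign_lists s.
      (Max ((\<lambda>x. (c x + U e S x) + 2 * l * u x z) ` F) + Max ((\<lambda>x. (c x + U e S x) - 2 * l * u x z) ` F)))))"
  proof -
    have "(\<Sum>S\<in>?R. q S * (a * (\<Sum>e\<in>sign_lists s. \<Sum>z\<in>?P. pmf p z * (b * M z S e)))) =
      (\<Sum>z\<in>?P. pmf p z * (\<Sum>S\<in>?R. q S * (a * b * (\<Sum>e\<in>sign_lists s. M z S e))))" for q a b and M :: "'z \<Rightarrow> 'z list \<Rightarrow> real list \<Rightarrow> real"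
    proof -
      have "(\<Sum>S\<in>?R. q S * (a * (\<Sum>e\<in>sign_lists s. \<Sum>z\<in>?P. pmf p z * (b * M z S e)))) =
        (\<Sum>S\<in>?R. \<Sum>e\<in>sign_lists s. \<Sum>z\<in>?P. q S * (a * b * (pmf p z * M z S e)))"
        by (simp add: sum_distrib_left mult_ac)
      also have "\<dots> = (\<Sum>S\<in>?R. \<Sum>z\<in>?P. \<Sum>e\<in>sign_lists s. q S * (a * b * (pmf p z * M z S e)))"
        by (intro sum.cong refl sum.swap)
      also have "\<dots> = (\<Sum>z\<in>?P. \<Sum>S\<in>?R. \<Sum>e\<in>sign_lists s. q S * (a * b * (pmf p z * M z S e)))"
        by (rule sum.swap)
      finally show ?thesis by (simp add: sum_distrib_left mult_ac)
    qed
    moreover have "1 / 2 ^ Suc s = 1 / 2 ^ s * (1 / 2 :: real)" by simp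
    ultimately show ?thesis unfolding expectation_finite_support[OF fR] by (simp only:)
  qed
  also have "\<dots> = measure_pmf.expectation (replicate_pmf (Suc s) p)
      (\<lambda>S. 1 / 2 ^ Suc s * (\<Sum>e\<in>sign_lists (Suc s). Max ((\<lambda>x. c x + 2 * l * (\<Sum>t<Suc s. e ! t * u x (S ! t))) ` F)))"
  proof -
    have "c x + 2 * l * (\<Sum>t<Suc s. (1 # e) ! t * u x ((z # S) ! t)) = (c x + U e S x) + 2 * l * u x z"
      "c x + 2 * l * (\<Sum>t<Suc s. (- 1 # e) ! t * u x ((z # S) ! t)) = (c x + U e S x) - 2 * l * u x z" for x e z S
      unfolding U_def sum.lessThan_Suc_shift by (simp_all add: algebra_simps)
    then show ?thesis unfolding expectation_replicate_pmf_Suc[OF p] sum_sign_lists_Suc by (simp only:)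
  qed
  finally show ?case .
qed

section \<open>Exponential moments and the largest row or column sum\<close>

lemma expectation_exp_sum_list:
  assumes p: "finite (set_pmf p)"
  shows "measure_pmf.expectation (replicate_pmf s p) (\<lambda>S. exp (\<Sum>z\<leftarrow>S. g z)) =
    (measure_pmf.expectation p (\<lambda>z. exp (g z :: real))) ^ s"
proof (induction s)
  case (Suc s)
  have "measure_pmf.expectation (replicate_pmf (Suc s) p) (\<lambda>S. exp (\<Sum>z\<leftarrow>S. g z)) =
    (\<Sum>z\<in>set_pmf p. pmf p z * (exp (g z) * measure_pmf.expectation p (\<lambda>z. exp (g z)) ^ s))"
    unfolding expectation_replicate_pmf_Suc[OF p] by (simp add: exp_add Suc.IH)
  also have "\<dots> = (\<Sum>z\<in>set_pmf p. pmf p z * exp (g z)) * measure_pmf.expectation p (\<lambda>z. exp (g z)) ^ s"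
    by (simp only: sum_distrib_right mult.assoc)
  also have "\<dots> = measure_pmf.expectation p (\<lambda>z. exp (g z)) ^ Suc s"
    unfolding expectation_finite_support[OF p] by simp
  finally show ?case .
qed simp

text \<open>On [0, 1] one has \<open>exp x \<le> 1 + x + x^2 \<le> 1 + 2 x\<close>; then
  \<open>1 + y \<le> exp y\<close> is applied to the mean. This is the factor 2 in the threshold
  T.\<close>

lemma expectation_exp_le:
  assumes p: "finite (set_pmf p)" and g: "\<And>z. z \<in> set_pmf p \<Longrightarrow> 0 \<le> g z \<and> g z \<le> (1::real)"
  shows "measure_pmf.expectation p (\<lambda>z. exp (g z)) \<le> exp (2 * measure_pmf.expectation p g)"
proof -
  have "measure_pmf.expectation p (\<lambda>z. exp (g z)) \<le> (\<Sum>z\<in>set_pmf p. pmf p z * (1 + 2 * g z))"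
    unfolding expectation_finite_support[OF p]
  proof (intro sum_mono mult_left_mono)
    fix z assume z: "z \<in> set_pmf p"
    have "exp (g z) \<le> 1 + g z + (g z)\<^sup>2" using g[OF z] by (intro exp_bound) auto
    also have "(g z)\<^sup>2 \<le> g z" using g[OF z] by (simp add: power2_eq_square mult_left_le)
    finally show "exp (g z) \<le> 1 + 2 * g z" by simp
  qed auto
  also have "\<dots> = 1 + 2 * measure_pmf.expectation p g"
    unfolding expectation_finite_support[OF p] by (rule sum_pmf_affine[OF p])
  also have "\<dots> \<le> exp (2 * measure_pmf.expectation p g)" by (rule exp_ge_add_one_self)
  finally show ?thesis .
qed

text \<open>A smooth upper bound for the maximum over \<open>i\<close>, since \<open>x - T \<le> exp (x - T)\<close>.\<close>

lemma expectation_sqrt_soft_max_le: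
  fixes g :: "nat \<Rightarrow> 'z \<Rightarrow> real" and s :: nat
  assumes p: "finite (set_pmf p)" and d: "d > 0"
    and g: "\<And>i z. i < d \<Longrightarrow> z \<in> set_pmf p \<Longrightarrow> 0 \<le> g i z \<and> g i z \<le> 1"
    and Eg: "\<And>i. i < d \<Longrightarrow> measure_pmf.expectation p (g i) \<le> \<alpha>" and \<alpha>: "\<alpha> \<ge> 0"
  defines "T \<equiv> ln (real d) + 2 * real s * \<alpha>"
  shows "measure_pmf.expectation (replicate_pmf s p) (\<lambda>S. sqrt (T + (\<Sum>i<d. exp ((\<Sum>z\<leftarrow>S. g i z) - T)))) \<le> sqrt (T + 1)"
proof -
  let ?q = "replicate_pmf s p"
  note fR = finite_set_replicate_pmf[OF p, of s]
  let ?V = "\<lambda>S. T + (\<Sum>i<d. exp ((\<Sum>z\<leftarrow>S. g i z) - T))"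
  have T: "T \<ge> 0" using d \<alpha> by (simp add: T_def)
  \<comment> \<open>Jensen's inequality for the square root, by means of the tangent at T + 1:
    \<open>sqrt v \<le> v / (2 c) + c / 2\<close>.\<close>
  define c where "c = sqrt (T + 1)"
  have c: "c > 0" "c * c = T + 1" using T by (auto simp: c_def)
  have "measure_pmf.expectation ?q ?V = (\<Sum>S\<in>set_pmf ?q. pmf ?q S * T) +
     (\<Sum>i<d. (\<Sum>S\<in>set_pmf ?q. pmf ?q S * exp (\<Sum>z\<leftarrow>S. g i z)) * exp (- T))"
  proof -
    have "measure_pmf.expectation ?q ?V = (\<Sum>S\<in>set_pmf ?q. pmf ?q S * T +
        (\<Sum>i<d. pmf ?q S * exp (\<Sum>z\<leftarrow>S. g i z) * exp (- T)))"
      unfolding expectation_finite_support[OF fR] distrib_left sum_distrib_left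
      by (simp add: exp_diff exp_minus divide_inverse mult.assoc)
    also have "\<dots> = (\<Sum>S\<in>set_pmf ?q. pmf ?q S * T) +
        (\<Sum>i<d. \<Sum>S\<in>set_pmf ?q. pmf ?q S * exp (\<Sum>z\<leftarrow>S. g i z) * exp (- T))"
      unfolding sum.distrib by (intro arg_cong2[of _ _ _ _ "(+)"] refl sum.swap)
    finally show ?thesis by (simp only: sum_distrib_right)
  qed
  also have "\<dots> = T + (\<Sum>i<d. measure_pmf.expectation p (\<lambda>z. exp (g i z)) ^ s * exp (- T))"
    unfolding sum_distrib_right[symmetric] sum_pmf_finite_support[OF fR]
      expectation_finite_support[OF fR, symmetric] expectation_exp_sum_list[OF p] by simp
  also have "\<dots> \<le> T + (\<Sum>i<d. exp (2 * \<alpha>) ^ s * exp (- T))"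
  proof (intro add_left_mono sum_mono mult_right_mono power_mono)
    fix i assume i: "i \<in> {..<d}"
    have "measure_pmf.expectation p (\<lambda>z. exp (g i z)) \<le> exp (2 * measure_pmf.expectation p (g i))"
      by (rule expectation_exp_le[OF p]) (use g i in auto)
    also have "\<dots> \<le> exp (2 * \<alpha>)" using Eg i by simp
    finally show "measure_pmf.expectation p (\<lambda>z. exp (g i z)) \<le> exp (2 * \<alpha>)" .
    show "0 \<le> measure_pmf.expectation p (\<lambda>z. exp (g i z))" by (rule integral_nonneg_AE) auto
  qed auto
  \<comment> \<open>T is chosen so that the d exponential terms together contribute exactly
    1.\<close>
  also have "(\<Sum>i<d. exp (2 * \<alpha>) ^ s * exp (- T)) = 1"
  proof -
    have "exp T = real d * exp (2 * \<alpha>) ^ s"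
      using d by (simp add: T_def exp_add exp_of_nat_mult[symmetric] mult_ac)
    then have "(\<Sum>i<d. exp (2 * \<alpha>) ^ s * exp (- T)) = exp T * exp (- T)" by simp
    then show ?thesis by (simp only: exp_minus_inverse)
  qed
  finally have EV: "measure_pmf.expectation ?q ?V \<le> T + 1" by simp
  have "measure_pmf.expectation ?q (\<lambda>S. sqrt (?V S)) \<le> (\<Sum>S\<in>set_pmf ?q. pmf ?q S * (1 / (2 * c) * ?V S + c / 2))"
    unfolding expectation_finite_support[OF fR]
  proof (intro sum_mono mult_left_mono)
    fix S
    define v where "v = ?V S"
    have v: "v \<ge> 0" using T by (auto simp: v_def intro!: add_nonneg_nonneg sum_nonneg)
    have "0 \<le> (sqrt v - c)\<^sup>2" by simp
    then have "2 * c * sqrt v \<le> v + c * c" using v by (simp add: power2_eq_square algebra_simps)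
    then have "sqrt v \<le> (v + c * c) / (2 * c)" using c(1) by (simp add: field_simps)
    also have "\<dots> = 1 / (2 * c) * v + c / 2" using c(1) by (simp add: field_simps)
    finally show "sqrt (?V S) \<le> 1 / (2 * c) * ?V S + c / 2" unfolding v_def .
  qed auto
  also have "\<dots> = 1 / (2 * c) * measure_pmf.expectation ?q ?V + c / 2"
    unfolding expectation_finite_support[OF fR]
    using sum_pmf_affine[OF fR, of "c / 2" "1 / (2 * c)" ?V] by (simp only: add.commute[of "c / 2"])
  also have "\<dots> \<le> 1 / (2 * c) * (c * c) + c / 2"
    unfolding c(2) using c(1) by (intro add_right_mono mult_left_mono EV) auto
  also have "\<dots> = c" using c(1) by simp
  finally show ?thesis unfolding c_def .
qed

section \<open>Excess risk\<close>

lemma expectation_mono_finite_support: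
  fixes f g :: "'a \<Rightarrow> real"
  assumes q: "finite (set_pmf q)" and "\<And>a. a \<in> set_pmf q \<Longrightarrow> f a \<le> g a"
  shows "measure_pmf.expectation q f \<le> measure_pmf.expectation q g"
  unfolding expectation_finite_support[OF q] using assms(2) by (intro sum_mono mult_left_mono) auto

lemma expectation_sum_list:
  fixes f :: "'a \<Rightarrow> real"
  assumes p: "finite (set_pmf p)"
  shows "measure_pmf.expectation (replicate_pmf s p) (\<lambda>S. \<Sum>z\<leftarrow>S. f z) = real s * measure_pmf.expectation p f"
proof (induction s)
  case (Suc s)
  have "measure_pmf.expectation (replicate_pmf s p) (\<lambda>S. f z + (\<Sum>z\<leftarrow>S. f z)) = real s * measure_pmf.expectation p f + 1 * f z" for z
    using sum_pmf_affine[OF finite_set_replicate_pmf[OF p, of s], of "f z" 1 "\<lambda>S. \<Sum>z\<leftarrow>S. f z"] Suc.IH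
    by (simp add: expectation_finite_support[OF finite_set_replicate_pmf[OF p]])
  then have "measure_pmf.expectation (replicate_pmf (Suc s) p) (\<lambda>S. \<Sum>z\<leftarrow>S. f z) =
    (\<Sum>z\<in>set_pmf p. pmf p z * (real s * measure_pmf.expectation p f + 1 * f z))"
    unfolding expectation_replicate_pmf_Suc[OF p] by simp
  also have "\<dots> = real s * measure_pmf.expectation p f + 1 * measure_pmf.expectation p f"
    unfolding sum_pmf_affine[OF p] expectation_finite_support[OF p] ..
  finally show ?case by (simp add: algebra_simps)
qed simp

lemma expectation_grid:
  fixes f :: "nat \<times> nat \<Rightarrow> real"
  assumes "set_pmf p \<subseteq> {..<n} \<times> {..<m}"
  shows "measure_pmf.expectation p f = (\<Sum>i<n. \<Sum>j<m. pmf p (i, j) * f (i, j))"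
proof -
  have "measure_pmf.expectation p f = (\<Sum>z\<in>{..<n} \<times> {..<m}. f z * pmf p z)"
    by (rule integral_measure_pmf_real) (use assms in auto)
  then show ?thesis by (simp add: sum.cartesian_product mult.commute split_def)
qed

lemma expectation_row:
  assumes "set_pmf p \<subseteq> {..<n} \<times> {..<m}" and i: "i < n"
  shows "measure_pmf.expectation p (\<lambda>z. of_bool (fst z = i) * c) = row_marginal m p i * c"
proof -
  have "measure_pmf.expectation p (\<lambda>z. of_bool (fst z = i) * c) =
      (\<Sum>k<n. if k = i then row_marginal m p i * c else 0)"
    unfolding expectation_grid[OF assms(1)] by (intro sum.cong refl) (simp add: row_marginal_def sum_distrib_right)
  then show ?thesis using i by simp
qed

lemma expectation_col:
  assumes "set_pmf p \<subseteq> {..<n} \<times> {..<m}" and j: "j < m"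
  shows "measure_pmf.expectation p (\<lambda>z. of_bool (snd z = j) * c) = col_marginal n p j * c"
proof -
  have "measure_pmf.expectation p (\<lambda>z. of_bool (snd z = j) * c) =
      (\<Sum>k<m. if k = j then col_marginal n p j * c else 0)"
    unfolding expectation_grid[OF assms(1)]
    by (subst sum.swap, intro sum.cong refl) (simp add: col_marginal_def sum_distrib_right)
  then show ?thesis using j by simp
qed

lemma expected_loss_eq_expectation:
  assumes "set_pmf p \<subseteq> {..<n} \<times> {..<m}"
  shows "expected_loss n m loss Y p X = measure_pmf.expectation p (\<lambda>z. loss (X $$ z) (Y $$ z))"
  by (simp add: expected_loss_def expectation_grid[OF assms])

lemma empirical_loss_eq:
  "empirical_loss loss Y S X = 1 / real (length S) * (\<Sum>z\<leftarrow>S. loss (X $$ z) (Y $$ z))"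
  by (simp add: empirical_loss_def split_def)

text \<open>A light entry lies in a row or a column of marginal below \<alpha>. There are at most n
  such rows and m such columns, each of mass at most \<alpha>.\<close>

lemma light_mass_le:
  assumes p: "set_pmf p \<subseteq> {..<n} \<times> {..<m}" and \<alpha>: "\<alpha> \<ge> 0"
  shows "measure_pmf.expectation p (\<lambda>z. of_bool (\<not> (\<alpha> \<le> row_marginal m p (fst z) \<and> \<alpha> \<le> col_marginal n p (snd z))))
     \<le> real n * \<alpha> + real m * \<alpha>"
proof -
  have "measure_pmf.expectation p (\<lambda>z. of_bool (\<not> (\<alpha> \<le> row_marginal m p (fst z) \<and> \<alpha> \<le> col_marginal n p (snd z))))
    \<le> (\<Sum>i<n. \<Sum>j<m. pmf p (i, j) * of_bool (row_marginal m p i < \<alpha>) + pmf p (i, j) * of_bool (col_marginal n p j < \<alpha>))"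
    unfolding expectation_grid[OF p] by (intro sum_mono) auto
  also have "\<dots> = (\<Sum>i<n. row_marginal m p i * of_bool (row_marginal m p i < \<alpha>)) +
      (\<Sum>j<m. col_marginal n p j * of_bool (col_marginal n p j < \<alpha>))"
    unfolding row_marginal_def col_marginal_def sum.distrib sum_distrib_right
    by (intro arg_cong2[of _ _ _ _ "(+)"] refl sum.swap)
  also have "\<dots> \<le> (\<Sum>i<n. \<alpha>) + (\<Sum>j<m. \<alpha>)"
    using \<alpha> by (intro add_mono sum_mono) auto
  finally show ?thesis by simp
qed

text \<open>The matrix inside the weighted trace norm; passing to it turns the weighted ball into an
  ordinary trace-norm ball, where duality applies.\<close>

definition scaled_mat :: "nat \<Rightarrow> nat \<Rightarrow> (nat \<times> nat) pmf \<Rightarrow> real mat \<Rightarrow> real mat" where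
  "scaled_mat n m p X = mat_diag n (\<lambda>i. sqrt (row_marginal m p i)) * X * mat_diag m (\<lambda>j. sqrt (col_marginal n p j))"

lemma scaled_mat_weighted_class:
  assumes "X \<in> weighted_class n m r p"
  shows "scaled_mat n m p X \<in> carrier_mat n m" "trace_norm (scaled_mat n m p X) \<le> sqrt r"
    "i < n \<Longrightarrow> j < m \<Longrightarrow> scaled_mat n m p X $$ (i, j) = sqrt (row_marginal m p i) * X $$ (i, j) * sqrt (col_marginal n p j)"
proof -
  have X: "X \<in> carrier_mat n m" using assms by (simp add: weighted_class_def)
  then show "scaled_mat n m p X \<in> carrier_mat n m"
    unfolding scaled_mat_def by (metis mat_diag_dim mult_carrier_mat)
  show "trace_norm (scaled_mat n m p X) \<le> sqrt r"
    using assms by (auto simp: weighted_class_def weighted_trace_norm_def scaled_mat_def)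
  show "scaled_mat n m p X $$ (i, j) = sqrt (row_marginal m p i) * X $$ (i, j) * sqrt (col_marginal n p j)"
    if "i < n" "j < m"
    using that X unfolding scaled_mat_def
    by (subst mat_diag_mult_right[of _ n m]) (auto simp: mat_diag_mult_left[OF X])
qed

text \<open>On heavy entries X is \<open>wt\<close> times its rescaling, so for a fixed sample the
  sign average is controlled on the trace-norm ball of radius \<open>sqrt r\<close> with variance
  bound \<open>V S / \<alpha>^2\<close>. The remaining average of \<open>sqrt (V S)\<close> over
  samples is the soft maximum estimate.\<close>

lemma weighted_class_max_rademacher_le:
  fixes n m s :: nat and p :: "(nat \<times> nat) pmf" and \<alpha> :: real
  defines "G \<equiv> \<lambda>z. \<alpha> \<le> row_marginal m p (fst z) \<and> \<alpha> \<le> col_marginal n p (snd z)"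
  assumes p: "set_pmf p \<subseteq> {..<n} \<times> {..<m}" and \<alpha>: "\<alpha> > 0" and r: "r \<ge> 0" and l: "l \<ge> 0"
    and F: "finite F" "F \<noteq> {}" "F \<subseteq> weighted_class n m r p"
    and k: "k \<ge> 1" and nk: "real (n + m) \<le> exp (real k)" and nm: "n + m > 0"
  defines "T \<equiv> ln (real (n + m)) + 2 * real s * \<alpha>"
  shows "measure_pmf.expectation (replicate_pmf s p)
      (\<lambda>S. 1 / 2 ^ s * (\<Sum>e\<in>sign_lists s. Max ((\<lambda>X. 0 + 2 * l * (\<Sum>t<s. e ! t * (of_bool (G (S ! t)) * X $$ (S ! t)))) ` F)))
    \<le> 4 * l * sqrt r / \<alpha> * sqrt (12 * exp 1 * real k * (T + 1))"
proof -
  have fp: "finite (set_pmf p)" using p by (rule finite_subset) simp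
  let ?pr = "row_marginal m p" and ?pc = "col_marginal n p"
  have pr0: "?pr i \<ge> 0" and pc0: "?pc i \<ge> 0" for i
    by (auto simp: row_marginal_def col_marginal_def intro!: sum_nonneg)
  define wt where "wt z = of_bool (G z) / sqrt (?pr (fst z) * ?pc (snd z))" for z
  have wt2: "(wt z)\<^sup>2 = of_bool (G z) / (?pr (fst z) * ?pc (snd z))" for z
    using pr0 pc0 by (simp add: wt_def power_divide)
  have wtr: "\<alpha>\<^sup>2 * (wt z)\<^sup>2 \<le> \<alpha> / ?pr (fst z)" and wtc: "\<alpha>\<^sup>2 * (wt z)\<^sup>2 \<le> \<alpha> / ?pc (snd z)"
    and wt1: "\<alpha>\<^sup>2 * (wt z)\<^sup>2 \<le> 1" for z
  proof -
    have "\<alpha>\<^sup>2 * (wt z)\<^sup>2 \<le> \<alpha> / ?pr (fst z) \<and> \<alpha>\<^sup>2 * (wt z)\<^sup>2 \<le> \<alpha> / ?pc (snd z) \<and> \<alpha>\<^sup>2 * (wt z)\<^sup>2 \<le> 1"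
    proof (cases "G z")
      case True
      then have g: "\<alpha> \<le> ?pr (fst z)" "\<alpha> \<le> ?pc (snd z)" by (auto simp: G_def)
      have eq: "\<alpha>\<^sup>2 * (wt z)\<^sup>2 = (\<alpha> / ?pr (fst z)) * (\<alpha> / ?pc (snd z))"
        unfolding wt2 using True by (simp add: power2_eq_square)
      have "0 \<le> \<alpha> / ?pr (fst z)" "\<alpha> / ?pr (fst z) \<le> 1" "0 \<le> \<alpha> / ?pc (snd z)" "\<alpha> / ?pc (snd z) \<le> 1"
        using g \<alpha> by auto
      moreover have "a * b \<le> a \<and> a * b \<le> b \<and> a * b \<le> 1" if "0 \<le> a" "a \<le> 1" "0 \<le> b" "b \<le> 1" for a b :: real
        using that by (auto intro: mult_left_le mult_left_le_one_le mult_le_one)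
      ultimately show ?thesis unfolding eq by blast
    next
      case False
      then show ?thesis unfolding wt2 using \<alpha> pr0 pc0 by simp
    qed
    then show "\<alpha>\<^sup>2 * (wt z)\<^sup>2 \<le> \<alpha> / ?pr (fst z)" "\<alpha>\<^sup>2 * (wt z)\<^sup>2 \<le> \<alpha> / ?pc (snd z)" "\<alpha>\<^sup>2 * (wt z)\<^sup>2 \<le> 1" by auto
  qed
  have wtA: "of_bool (G z) * X $$ z = wt z * scaled_mat n m p X $$ z"
    if X: "X \<in> weighted_class n m r p" and z: "z \<in> {..<n} \<times> {..<m}" for X z
  proof (cases "G z")
    case True
    obtain i j where ij: "z = (i, j)" by (cases z)
    have "sqrt (?pr i) > 0" "sqrt (?pc j) > 0" using True \<alpha> by (auto simp: G_def ij)
    then show ?thesis using True z scaled_mat_weighted_class(3)[OF X, of i j]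
      by (simp add: wt_def ij real_sqrt_mult field_simps)
  qed (simp add: wt_def)
  \<comment> \<open>As in the dilation, x < n stands for a row and n + j for column j. The factor
    \<open>\<alpha>^2\<close> brings the squared weights into [0, 1], as the exponential moment
    bound requires, and makes the mean of each \<open>g x\<close> at most \<alpha>.\<close>
  define g where "g x z = \<alpha>\<^sup>2 * (wt z)\<^sup>2 * of_bool (if x < n then fst z = x else snd z = x - n)" for x z
  have g01: "0 \<le> g x z \<and> g x z \<le> 1" for x z
    using wt1[of z] by (auto simp: g_def)
  have Eg: "measure_pmf.expectation p (g x) \<le> \<alpha>" if x: "x < n + m" for x
  proof (cases "x < n")
    case True
    have "measure_pmf.expectation p (g x) \<le> measure_pmf.expectation p (\<lambda>z. of_bool (fst z = x) * (\<alpha> / ?pr x))"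
      using wtr True by (intro expectation_mono_finite_support[OF fp]) (auto simp: g_def)
    \<comment> \<open>The row probability cancels the marginal; for a row of mass zero, division by
      zero yields 0, which is also below \<alpha>.\<close>
    also have "\<dots> \<le> \<alpha>" unfolding expectation_row[OF p True] using \<alpha> by simp
    finally show ?thesis .
  next
    case False
    have "measure_pmf.expectation p (g x) \<le> measure_pmf.expectation p (\<lambda>z. of_bool (snd z = x - n) * (\<alpha> / ?pc (x - n)))"
      using wtc False by (intro expectation_mono_finite_support[OF fp]) (auto simp: g_def)
    also have "\<dots> \<le> \<alpha>"
    proof -
      have "x - n < m" using x False by linarith
      then show ?thesis using \<alpha> by (simp only: expectation_col[OF p]) simp
    qed
    finally show ?thesis .
  qed
  define V where "V S = T + (\<Sum>x<n+m. exp ((\<Sum>z\<leftarrow>S. g x z) - T))" for S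
  have "1 \<le> real (n + m)" using nm by linarith
  then have T0: "T \<ge> 0" unfolding T_def using \<alpha> by (intro add_nonneg_nonneg ln_ge_zero) auto
  have Vpos: "V S > 0" for S
    unfolding V_def using T0 nm by (intro add_nonneg_pos sum_pos) (auto simp: lessThan_empty_iff)
  have Vg: "(\<Sum>z\<leftarrow>S. g x z) \<le> V S" if "x < n + m" for x S
  proof -
    have "(\<Sum>z\<leftarrow>S. g x z) - T \<le> exp ((\<Sum>z\<leftarrow>S. g x z) - T)"
      using exp_ge_add_one_self[of "(\<Sum>z\<leftarrow>S. g x z) - T"] by linarith
    also have "\<dots> \<le> (\<Sum>x<n+m. exp ((\<Sum>z\<leftarrow>S. g x z) - T))"
      by (rule member_le_sum) (use that in auto)
    finally show ?thesis by (simp add: V_def)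
  qed
  define c where "c = 4 * l * sqrt r * (sqrt (12 * exp 1 * real k) / \<alpha>)"
  have c0: "c \<ge> 0" using l r \<alpha> by (simp add: c_def)
  have "measure_pmf.expectation (replicate_pmf s p)
      (\<lambda>S. 1 / 2 ^ s * (\<Sum>e\<in>sign_lists s. Max ((\<lambda>X. 0 + 2 * l * (\<Sum>t<s. e ! t * (of_bool (G (S ! t)) * X $$ (S ! t)))) ` F)))
    \<le> measure_pmf.expectation (replicate_pmf s p) (\<lambda>S. c * sqrt (V S))"
  proof (rule expectation_mono_finite_support[OF finite_set_replicate_pmf[OF fp]])
    fix S assume "S \<in> set_pmf (replicate_pmf s p)"
    then have len: "length S = s" and S: "set S \<subseteq> {..<n} \<times> {..<m}"
      using p by (auto simp: set_replicate_pmf)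
    have St: "S ! t \<in> {..<n} \<times> {..<m}" if "t < s" for t
      using that S len by (metis nth_mem subsetD)
    let ?f = "\<lambda>e X. 0 + 2 * l * (\<Sum>t<s. e ! t * (of_bool (G (S ! t)) * X $$ (S ! t)))"
    have "\<forall>e. \<exists>X. X \<in> F \<and> Max (?f e ` F) = ?f e X"
      using Max_image_attained[OF F(1,2)] by (simp only: Bex_def) blast
    from choice[OF this] obtain Xm where "\<forall>e. Xm e \<in> F \<and> Max (?f e ` F) = ?f e (Xm e)" ..
    then have Xm: "Xm e \<in> F" "Max (?f e ` F) = ?f e (Xm e)" for e by blast+
    have XF: "Xm e \<in> weighted_class n m r p" for e using Xm(1) F(3) by blast
    have gs: "(\<Sum>t<s. g x (S ! t)) \<le> V S" if "x < n + m" for x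
      using Vg[OF that, of S] len by (simp add: sum_list_sum_nth atLeast0LessThan)
    have "Max (?f e ` F) = 2 * l * (\<Sum>t<s. e ! t * (wt (S ! t) * scaled_mat n m p (Xm e) $$ (S ! t)))" for e
    proof -
      have "(\<Sum>t<s. e ! t * (of_bool (G (S ! t)) * Xm e $$ (S ! t))) =
        (\<Sum>t<s. e ! t * (wt (S ! t) * scaled_mat n m p (Xm e) $$ (S ! t)))"
        by (intro sum.cong refl) (simp only: wtA[OF XF St] lessThan_iff)
      then show ?thesis using Xm(2)[of e] by (simp only: add_0)
    qed
    then have "(\<Sum>e\<in>sign_lists s. Max (?f e ` F)) =
      2 * l * (\<Sum>e\<in>sign_lists s. \<Sum>t<s. e ! t * (wt (S ! t) * scaled_mat n m p (Xm e) $$ (S ! t)))"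
      by (simp only: sum_distrib_left[symmetric])
    also have "\<dots> \<le> 2 * l * (2 ^ s * (sqrt r * (2 * sqrt (exp 1 * (12 * real k * (V S / \<alpha>\<^sup>2))))))"
    proof (intro mult_left_mono rademacher_trace_norm_ball[OF len S])
      fix i assume i: "i < n"
      have "\<alpha>\<^sup>2 * (\<Sum>t<s. (wt (S ! t))\<^sup>2 * of_bool (fst (S ! t) = i)) = (\<Sum>t<s. g i (S ! t))"
        unfolding g_def sum_distrib_left using i by (intro sum.cong refl) simp
      then show "(\<Sum>t<s. (wt (S ! t))\<^sup>2 * of_bool (fst (S ! t) = i)) \<le> V S / \<alpha>\<^sup>2"
        using gs[of i] i \<alpha> by (simp add: field_simps)
    next
      fix j assume j: "j < m"
      have "\<alpha>\<^sup>2 * (\<Sum>t<s. (wt (S ! t))\<^sup>2 * of_bool (snd (S ! t) = j)) = (\<Sum>t<s. g (n + j) (S ! t))"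
        unfolding g_def sum_distrib_left by (intro sum.cong refl) simp
      then show "(\<Sum>t<s. (wt (S ! t))\<^sup>2 * of_bool (snd (S ! t) = j)) \<le> V S / \<alpha>\<^sup>2"
        using gs[of "n + j"] j \<alpha> by (simp add: field_simps)
    qed (use k nk Vpos \<alpha> r l scaled_mat_weighted_class(1,2)[OF XF] in auto)
    also have "sqrt (exp 1 * (12 * real k * (V S / \<alpha>\<^sup>2))) = sqrt (12 * exp 1 * real k) / \<alpha> * sqrt (V S)"
      using \<alpha> by (simp add: real_sqrt_mult real_sqrt_divide)
    finally have "(\<Sum>e\<in>sign_lists s. Max (?f e ` F)) \<le> 2 ^ s * (c * sqrt (V S))"
      by (simp add: c_def mult_ac)
    then show "1 / 2 ^ s * (\<Sum>e\<in>sign_lists s. Max (?f e ` F)) \<le> c * sqrt (V S)"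
      by (simp add: field_simps)
  qed
  also have "\<dots> = c * measure_pmf.expectation (replicate_pmf s p) (\<lambda>S. sqrt (V S))" by simp
  also have "\<dots> \<le> c * sqrt (T + 1)"
    unfolding V_def T_def
    by (intro mult_left_mono[OF _ c0] expectation_sqrt_soft_max_le[OF fp nm g01 Eg]) (use \<alpha> in auto)
  also have "\<dots> = 4 * l * sqrt r / \<alpha> * sqrt (12 * exp 1 * real k * (T + 1))"
    by (simp add: c_def real_sqrt_mult)
  finally show ?thesis .
qed


text \<open>Here \<alpha> is already balanced: the last hypothesis equates \<open>n \<alpha>\<close>
  with \<open>sqrt (r ln n / (s \<alpha>))\<close>. Light entries of the minimizer are charged to
  boundedness twice, in the expected and in the empirical loss, each time with mass at most
  \<open>2 n \<alpha>\<close>; hence 4 b. Heavy entries give 120 l.\<close>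

lemma excess_risk_le:
  fixes n m s :: nat and p :: "(nat \<times> nat) pmf" and \<alpha> :: real
  assumes nm: "n \<ge> m" "m \<ge> 1" "n \<ge> 2" and s: "s \<ge> 1" and r: "r \<ge> 1"
    and p: "set_pmf p \<subseteq> {..<n} \<times> {..<m}"
    and lip: "lipschitz_loss l loss" and bnd: "bounded_loss b loss" and l: "l \<ge> 0" and b: "b \<ge> 0"
    and Xhat: "\<And>S. S \<in> set_pmf (replicate_pmf s p) \<Longrightarrow>
      is_arg_min (empirical_loss loss Y S) (\<lambda>X. X \<in> weighted_class n m r p) (Xhat S)"
    and X0: "X0 \<in> weighted_class n m r p"
    and \<alpha>: "\<alpha> > 0" "real n * \<alpha> \<le> 1" "r * ln (real n) = (real n * \<alpha>)\<^sup>2 * (real s * \<alpha>)"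
  shows "measure_pmf.expectation (replicate_pmf s p) (\<lambda>S. expected_loss n m loss Y p (Xhat S))
    \<le> expected_loss n m loss Y p X0 + (4 * b + 120 * l) * (real n * \<alpha>)"
proof -
  let ?q = "replicate_pmf s p"
  let ?pr = "row_marginal m p" and ?pc = "col_marginal n p"
  let ?L = "\<lambda>X. measure_pmf.expectation p (\<lambda>z. loss (X $$ z) (Y $$ z))"
  have fp: "finite (set_pmf p)" using p by (rule finite_subset) simp
  note fq = finite_set_replicate_pmf[OF fp, of s]
  define G where "G z \<longleftrightarrow> \<alpha> \<le> ?pr (fst z) \<and> \<alpha> \<le> ?pc (snd z)" for z
  \<comment> \<open>Loss and entry are truncated by the same indicator, so \<open>h\<close> remains
    l-Lipschitz in \<open>u\<close> and contraction is unaffected by the truncation.\<close>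
  define h where "h X z = of_bool (G z) * loss (X $$ z) (Y $$ z)" for X z
  define u where "u X z = of_bool (G z) * X $$ z" for X :: "real mat" and z
  define B :: real where "B = measure_pmf.expectation p (\<lambda>z. of_bool (\<not> G z))"
  \<comment> \<open>The minimizers over all possible samples: a finite class that does not depend on
    the realized sample, as symmetrization needs.\<close>
  define F where "F = Xhat ` set_pmf ?q"
  have F: "finite F" "F \<noteq> {}" using fq by (auto simp: F_def set_pmf_not_empty)
  have XF: "Xhat S \<in> weighted_class n m r p" if "S \<in> set_pmf ?q" for S
    using Xhat[OF that] by (simp add: is_arg_min_def)
  then have FW: "F \<subseteq> weighted_class n m r p" by (auto simp: F_def)
  have BB: "B \<le> 2 * (real n * \<alpha>)"
  proof -
    have "B \<le> real n * \<alpha> + real m * \<alpha>"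
      unfolding B_def G_def by (rule light_mass_le[OF p]) (use \<alpha> in simp)
    moreover have "real m * \<alpha> \<le> real n * \<alpha>" using nm \<alpha> by (intro mult_right_mono) auto
    ultimately show ?thesis by linarith
  qed
  have lb: "\<bar>loss x y\<bar> \<le> b" for x y using bnd by (simp add: bounded_loss_def)
  define Mx where "Mx S = Max ((\<lambda>X. 0 + (\<Sum>z\<leftarrow>S. measure_pmf.expectation p (h X) - h X z)) ` F)" for S
  define k where "k = nat \<lceil>ln (real (n + m))\<rceil>"
  define T where "T = ln (real (n + m)) + 2 * real s * \<alpha>"
  have lnn: "ln (real n) > 0" and n0: "real n > 0" using nm by auto
  have ln2: "ln 2 \<le> ln (real n)" using nm by simp
  have "1 / 2 \<le> ln (2 :: real)" using ln_le_minus_one[of "1 / 2 :: real"] by (simp add: ln_div)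
  \<comment> \<open>Absorbs the additive ones, from rounding up k and from \<open>T + 1\<close>,
    into multiples of \<open>ln n\<close>; this uses n \<ge> 2.\<close>
  then have ln1: "1 \<le> 2 * ln (real n)" using ln2 by linarith
  have "ln (real (n + m)) \<le> ln (2 * real n)" using nm by (subst ln_le_cancel_iff) auto
  also have "\<dots> = ln 2 + ln (real n)" using n0 by (simp add: ln_mult)
  finally have lnm: "ln (real (n + m)) \<le> 2 * ln (real n)" using ln2 by linarith
  have lnm0: "ln (real (n + m)) > 0" using nm by simp
  have k: "k \<ge> 1" "ln (real (n + m)) \<le> real k" "real k \<le> 4 * ln (real n)"
    using lnm0 lnm ln1 unfolding k_def by linarith+
  have nk: "real (n + m) \<le> exp (real k)"
  proof -
    have "real (n + m) = exp (ln (real (n + m)))" using nm by simp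
    also have "\<dots> \<le> exp (real k)" using k(2) by simp
    finally show ?thesis .
  qed
  have sa: "real s * \<alpha> > 0" using s \<alpha> by simp
  \<comment> \<open>Since r \<ge> 1 and n\<alpha> \<le> 1, the balance forces
    \<open>s \<alpha>\<close> to be at least \<open>ln n\<close>, so the logarithm in T is of no
    larger order than \<open>s \<alpha>\<close>.\<close>
  have "ln (real n) \<le> r * ln (real n)" using r lnn by simp
  also have "\<dots> \<le> 1 * (real s * \<alpha>)" unfolding \<alpha>(3)
    using sa \<alpha> n0 by (intro mult_right_mono power_le_one) auto
  finally have lsa: "ln (real n) \<le> real s * \<alpha>" by simp
  have T: "T + 1 \<le> 6 * (real s * \<alpha>)" "0 \<le> T"
  proof -
    have "T = ln (real (n + m)) + 2 * (real s * \<alpha>)" by (simp add: T_def)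
    then show "T + 1 \<le> 6 * (real s * \<alpha>)" "0 \<le> T" using lnm lnm0 ln1 lsa sa by linarith+
  qed
  have "measure_pmf.expectation ?q Mx \<le> measure_pmf.expectation ?q
      (\<lambda>S. 1 / 2 ^ s * (\<Sum>e\<in>sign_lists s. Max ((\<lambda>X. 0 + 2 * l * (\<Sum>t<s. e ! t * u X (S ! t))) ` F)))"
    unfolding Mx_def
  proof (rule symmetrization_contraction[OF fp F])
    fix X X' z
    have "\<bar>loss (X $$ z) (Y $$ z) - loss (X' $$ z) (Y $$ z)\<bar> \<le> l * \<bar>X $$ z - X' $$ z\<bar>"
      using lip by (simp add: lipschitz_loss_def)
    then show "\<bar>h X z - h X' z\<bar> \<le> l * \<bar>u X z - u X' z\<bar>" by (auto simp: h_def u_def)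
  qed
  also have "\<dots> \<le> 4 * l * sqrt r / \<alpha> * sqrt (12 * exp 1 * real k * (T + 1))"
    unfolding u_def G_def T_def
    by (rule weighted_class_max_rademacher_le[OF p \<alpha>(1) _ l F FW k(1) nk]) (use r nm in auto)
  also have "\<dots> \<le> 4 * l * sqrt r / \<alpha> * (30 * (real s * \<alpha>) * (real n * \<alpha>) / sqrt r)"
  proof (rule mult_left_mono)
    \<comment> \<open>With e \<le> 3 the constants multiply to 864, rounded up to the square of 30;
      together with the prefactor 4 this gives 120.\<close>
    have "12 * exp 1 * real k * (T + 1) \<le> (12 * 3) * (4 * ln (real n)) * (6 * (real s * \<alpha>))"
      using k T exp_le by (intro mult_mono) auto
    also have "\<dots> = 864 * (ln (real n) * (real s * \<alpha>))" by simp
    also have "\<dots> \<le> 900 * (ln (real n) * (real s * \<alpha>))"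
      using mult_nonneg_nonneg[OF less_imp_le[OF lnn] less_imp_le[OF sa]] by (rule mult_right_mono[rotated]) simp
    also have "\<dots> = (30 * (real s * \<alpha>) * (real n * \<alpha>) / sqrt r)\<^sup>2"
    proof -
      have "ln (real n) = (real n * \<alpha>)\<^sup>2 * (real s * \<alpha>) / r" using \<alpha>(3) r by (simp add: field_simps)
      then show ?thesis using r by (simp add: power_divide power_mult_distrib power2_eq_square)
    qed
    finally show "sqrt (12 * exp 1 * real k * (T + 1)) \<le> 30 * (real s * \<alpha>) * (real n * \<alpha>) / sqrt r"
      using sa \<alpha> n0 r by (intro real_le_lsqrt) auto
  qed (use l r \<alpha> in auto)
  also have "\<dots> = real s * (120 * l * (real n * \<alpha>))" using \<alpha>(1) r by simp
  finally have EM: "measure_pmf.expectation ?q Mx \<le> real s * (120 * l * (real n * \<alpha>))" .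
  \<comment> \<open>Only the data-dependent \<open>Xhat S\<close> is truncated and bounded
    uniformly. The comparator \<open>X0\<close> is fixed, so its empirical loss has the right mean
    and costs nothing.\<close>
  have pw: "real s * ?L (Xhat S) \<le> Mx S + (real s * b * B + b * (\<Sum>z\<leftarrow>S. of_bool (\<not> G z))) + (\<Sum>z\<leftarrow>S. loss (X0 $$ z) (Y $$ z))"
    if S: "S \<in> set_pmf ?q" for S
  proof -
    let ?X = "Xhat S"
    have len: "length S = s" using S by (simp add: set_replicate_pmf)
    have "empirical_loss loss Y S ?X \<le> empirical_loss loss Y S X0"
      using Xhat[OF S] X0 by (auto simp: is_arg_min_def not_less)
    then have 1: "(\<Sum>z\<leftarrow>S. loss (?X $$ z) (Y $$ z)) \<le> (\<Sum>z\<leftarrow>S. loss (X0 $$ z) (Y $$ z))"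
      using s by (simp add: empirical_loss_eq len divide_le_cancel)
    have "0 + (\<Sum>z\<leftarrow>S. measure_pmf.expectation p (h ?X) - h ?X z) \<le> Mx S"
      unfolding Mx_def using F(1) S by (intro Max_ge) (auto simp: F_def)
    moreover have "(\<Sum>z\<leftarrow>S. measure_pmf.expectation p (h ?X) - h ?X z) =
      real s * measure_pmf.expectation p (h ?X) - (\<Sum>z\<leftarrow>S. h ?X z)"
      by (simp add: sum_list_subtractf sum_list_triv len)
    ultimately have 2: "real s * measure_pmf.expectation p (h ?X) - (\<Sum>z\<leftarrow>S. h ?X z) \<le> Mx S" by simp
    have "?L ?X \<le> (\<Sum>z\<in>set_pmf p. pmf p z * h ?X z + b * (pmf p z * of_bool (\<not> G z)))"
      unfolding expectation_finite_support[OF fp]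
    proof (rule sum_mono)
      fix z
      have "loss (?X $$ z) (Y $$ z) \<le> h ?X z + b * of_bool (\<not> G z)"
        using lb[of "?X $$ z" "Y $$ z"] by (auto simp: h_def)
      then have "pmf p z * loss (?X $$ z) (Y $$ z) \<le> pmf p z * (h ?X z + b * of_bool (\<not> G z))"
        by (rule mult_left_mono) simp
      then show "pmf p z * loss (?X $$ z) (Y $$ z) \<le> pmf p z * h ?X z + b * (pmf p z * of_bool (\<not> G z))"
        by (simp add: algebra_simps)
    qed
    also have "\<dots> = measure_pmf.expectation p (h ?X) + b * B"
      unfolding B_def expectation_finite_support[OF fp] by (simp only: sum.distrib sum_distrib_left)
    finally have "real s * ?L ?X \<le> real s * (measure_pmf.expectation p (h ?X) + b * B)"
      by (rule mult_left_mono) simp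
    then have 3: "real s * ?L ?X \<le> real s * measure_pmf.expectation p (h ?X) + real s * b * B"
      by (simp only: distrib_left mult.assoc)
    have 4: "(\<Sum>z\<leftarrow>S. h ?X z) \<le> (\<Sum>z\<leftarrow>S. loss (?X $$ z) (Y $$ z)) + b * (\<Sum>z\<leftarrow>S. of_bool (\<not> G z))"
      unfolding sum_list_const_mult[symmetric] sum_list_addf[symmetric]
    proof (rule sum_list_mono)
      fix z
      show "h ?X z \<le> loss (?X $$ z) (Y $$ z) + b * of_bool (\<not> G z)"
        using lb[of "?X $$ z" "Y $$ z"] by (auto simp: h_def)
    qed
    show ?thesis using 1 2 3 4 by linarith
  qed
  have "real s * measure_pmf.expectation ?q (\<lambda>S. ?L (Xhat S)) = measure_pmf.expectation ?q (\<lambda>S. real s * ?L (Xhat S))"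
    by simp
  also have "\<dots> \<le> measure_pmf.expectation ?q
      (\<lambda>S. Mx S + (real s * b * B + b * (\<Sum>z\<leftarrow>S. of_bool (\<not> G z))) + (\<Sum>z\<leftarrow>S. loss (X0 $$ z) (Y $$ z)))"
    by (rule expectation_mono_finite_support[OF fq pw])
  also have "\<dots> = measure_pmf.expectation ?q Mx + (real s * b * B + b * (real s * B)) + real s * ?L X0"
  proof -
    have int: "integrable (measure_pmf ?q) f" for f :: "(nat \<times> nat) list \<Rightarrow> real"
      by (rule integrable_measure_pmf_finite[OF fq])
    show ?thesis
      unfolding B_def expectation_sum_list[OF fp, symmetric]
      by (simp add: Bochner_Integration.integral_add[OF int int])
  qed
  also have "\<dots> \<le> real s * (120 * l * (real n * \<alpha>)) + (real s * b * (2 * (real n * \<alpha>)) + b * (real s * (2 * (real n * \<alpha>)))) + real s * ?L X0"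
    using EM BB b by (intro add_mono mult_left_mono) auto
  also have "\<dots> = real s * (?L X0 + (4 * b + 120 * l) * (real n * \<alpha>))" by (simp add: algebra_simps)
  finally show ?thesis using s by (simp add: expected_loss_eq_expectation[OF p])
qed

section \<open>Degenerate regimes and the choice of the threshold\<close>

lemma expected_loss_abs_le:
  assumes p: "set_pmf p \<subseteq> {..<n} \<times> {..<m}" and bnd: "bounded_loss b loss"
  shows "\<bar>expected_loss n m loss Y p X\<bar> \<le> b"
proof -
  have fp: "finite (set_pmf p)" using p by (rule finite_subset) simp
  have *: "\<bar>loss x y\<bar> \<le> b" for x y using bnd by (simp add: bounded_loss_def)
  have "\<bar>expected_loss n m loss Y p X\<bar> \<le> (\<Sum>z\<in>set_pmf p. \<bar>pmf p z * loss (X $$ z) (Y $$ z)\<bar>)"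
    unfolding expected_loss_eq_expectation[OF p] expectation_finite_support[OF fp] by (rule sum_abs)
  also have "\<dots> \<le> (\<Sum>z\<in>set_pmf p. pmf p z * b)"
    unfolding abs_mult using * by (intro sum_mono mult_mono) auto
  also have "\<dots> = b" by (simp add: sum_distrib_right[symmetric] sum_pmf_finite_support[OF fp])
  finally show ?thesis .
qed

text \<open>For n = 1 the error term is zero. On a one-point grid p is a point mass, so minimizing
  the empirical loss minimizes the expected loss exactly.\<close>

lemma expected_loss_eq_empirical_loss_single:
  assumes p: "set_pmf p \<subseteq> {..<1} \<times> {..<1}" and S: "S \<in> set_pmf (replicate_pmf s p)" and s: "s \<ge> 1"
  shows "expected_loss 1 1 loss Y p X = empirical_loss loss Y S X"
proof -
  have "set_pmf p \<subseteq> {(0, 0)}" using p by auto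
  then have "p = return_pmf (0, 0)" by (rule set_pmf_subset_singleton[THEN iffD1])
  moreover from this S have "S = replicate s (0, 0)"
    by (auto simp: set_replicate_pmf replicate_eqI)
  ultimately show ?thesis
    using s by (simp add: expected_loss_def empirical_loss_eq sum_list_triv map_replicate_const[symmetric] sum_list_replicate)
qed

theorem theorem2:
  shows "\<exists>K::real. \<forall>(n::nat) (m::nat) (Y::real mat) (s::nat) (r::real) (p::(nat \<times> nat) pmf)
      (loss::real \<Rightarrow> real \<Rightarrow> real) (l::real) (b::real) (Xhat::(nat \<times> nat) list \<Rightarrow> real mat).
      n \<ge> m \<longrightarrow> m \<ge> 1 \<longrightarrow> Y \<in> carrier_mat n m \<longrightarrow> s \<ge> 1 \<longrightarrow> r \<ge> 1 \<longrightarrow>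
      set_pmf p \<subseteq> {..<n} \<times> {..<m} \<longrightarrow>
      lipschitz_loss l loss \<longrightarrow> bounded_loss b loss \<longrightarrow>
      (\<forall>S \<in> set_pmf (replicate_pmf s p).
         is_arg_min (empirical_loss loss Y S) (\<lambda>X. X \<in> weighted_class n m r p) (Xhat S)) \<longrightarrow>
      measure_pmf.expectation (replicate_pmf s p) (\<lambda>S. expected_loss n m loss Y p (Xhat S))
        \<le> (INF X \<in> weighted_class n m r p. expected_loss n m loss Y p X)
           + K * (l + b) * root 3 (r * real n * ln (real n) / real s)"
proof (rule exI[of _ 120], intro allI impI)
  fix n m :: nat and Y :: "real mat" and s :: nat and r :: real and p :: "(nat \<times> nat) pmf"
    and loss :: "real \<Rightarrow> real \<Rightarrow> real" and l b :: real and Xhat :: "(nat \<times> nat) list \<Rightarrow> real mat"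
  assume nm: "n \<ge> m" "m \<ge> 1" and s: "s \<ge> 1" and r: "r \<ge> 1"
    and p: "set_pmf p \<subseteq> {..<n} \<times> {..<m}"
    and lip: "lipschitz_loss l loss" and bnd: "bounded_loss b loss"
    and Xhat: "\<forall>S \<in> set_pmf (replicate_pmf s p).
         is_arg_min (empirical_loss loss Y S) (\<lambda>X. X \<in> weighted_class n m r p) (Xhat S)"
  let ?E = "measure_pmf.expectation (replicate_pmf s p) (\<lambda>S. expected_loss n m loss Y p (Xhat S))"
  define \<rho> where "\<rho> = root 3 (r * real n * ln (real n) / real s)"
  have "\<bar>loss 1 0 - loss 0 0\<bar> \<le> l * \<bar>1 - 0\<bar>" using lip unfolding lipschitz_loss_def by blast
  then have l: "l \<ge> 0" by simp
  have "\<bar>loss 0 0\<bar> \<le> b" using bnd unfolding bounded_loss_def by blast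
  then have b: "b \<ge> 0" by linarith
  have fp: "finite (set_pmf p)" using p by (rule finite_subset) simp
  note fq = finite_set_replicate_pmf[OF fp, of s]
  obtain S0 where S0: "S0 \<in> set_pmf (replicate_pmf s p)" using set_pmf_not_empty[of "replicate_pmf s p"] by blast
  then have ne: "weighted_class n m r p \<noteq> {}" using Xhat by (auto simp: is_arg_min_def)
  have x0: "r * real n * ln (real n) / real s \<ge> 0" using r nm by simp
  \<comment> \<open>The bound is proved against every competitor, since the infimum need not be
    attained.\<close>
  have main: "?E \<le> expected_loss n m loss Y p X0 + 120 * (l + b) * \<rho>" if X0: "X0 \<in> weighted_class n m r p" for X0
  proof (cases "n = 1")
    case True
    then have [simp]: "n = 1" "m = 1" using nm by auto
    have "expected_loss n m loss Y p (Xhat S) \<le> expected_loss n m loss Y p X0" if S: "S \<in> set_pmf (replicate_pmf s p)" for S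
    proof -
      have "empirical_loss loss Y S (Xhat S) \<le> empirical_loss loss Y S X0"
        using Xhat S X0 by (auto simp: is_arg_min_def not_less)
      then show ?thesis using expected_loss_eq_empirical_loss_single[OF _ S s] p by simp
    qed
    then have "?E \<le> measure_pmf.expectation (replicate_pmf s p) (\<lambda>S. expected_loss n m loss Y p X0)"
      by (rule expectation_mono_finite_support[OF fq])
    then show ?thesis by (simp add: \<rho>_def)
  next
    case False
    then have n2: "n \<ge> 2" using nm by simp
    show ?thesis
    proof (cases "\<rho> \<le> 1")
      case True
      have pos: "r * real n * ln (real n) / real s > 0" using r n2 s by simp
      then have \<rho>0: "\<rho> > 0" by (simp add: \<rho>_def)
      have \<rho>3: "\<rho> ^ 3 = r * real n * ln (real n) / real s"
        unfolding \<rho>_def using x0 by (intro real_root_pow_pos2) auto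
      \<comment> \<open>This makes \<open>n \<alpha>\<close> equal to the cube root \<rho>, and the
        balance condition is then the identity for \<open>\<rho> ^ 3\<close>.\<close>
      define \<alpha> where "\<alpha> = \<rho> / real n"
      have n\<alpha>: "real n * \<alpha> = \<rho>" using n2 by (simp add: \<alpha>_def)
      have "r * ln (real n) = (real n * \<alpha>)\<^sup>2 * (real s * \<alpha>)"
      proof -
        have "(real n * \<alpha>)\<^sup>2 * (real s * \<alpha>) = \<rho> ^ 3 * real s / real n"
          unfolding n\<alpha> by (simp add: \<alpha>_def power2_eq_square power3_eq_cube)
        then show ?thesis unfolding \<rho>3 using s n2 by simp
      qed
      then have "?E \<le> expected_loss n m loss Y p X0 + (4 * b + 120 * l) * (real n * \<alpha>)"
        using nm n2 s r p lip bnd l b Xhat X0 \<rho>0 True n\<alpha>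
        by (intro excess_risk_le) (auto simp: \<alpha>_def)
      also have "(4 * b + 120 * l) * (real n * \<alpha>) \<le> 120 * (l + b) * \<rho>"
        unfolding n\<alpha> using \<rho>0 b by (intro mult_right_mono) auto
      finally show ?thesis by simp
    next
      case False
      \<comment> \<open>For \<rho> > 1 no probability is involved: two expected losses differ by at
        most 2 b, which the error term exceeds.\<close>
      have "expected_loss n m loss Y p X \<le> b" "- b \<le> expected_loss n m loss Y p X" for X
        using expected_loss_abs_le[OF p bnd, where X = X and Y = Y] by auto
      note lb = this
      have "?E \<le> measure_pmf.expectation (replicate_pmf s p) (\<lambda>S. b)"
        by (rule expectation_mono_finite_support[OF fq]) (rule lb)
      moreover have "2 * b \<le> 120 * (l + b) * \<rho>"
      proof -
        have "2 * b \<le> 120 * (l + b) * 1" using l b by simp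
        also have "\<dots> \<le> 120 * (l + b) * \<rho>" using False l b by (intro mult_left_mono) auto
        finally show ?thesis .
      qed
      ultimately show ?thesis using lb(2)[of X0] by simp
    qed
  qed
  have "?E - 120 * (l + b) * \<rho> \<le> (INF X \<in> weighted_class n m r p. expected_loss n m loss Y p X)"
    by (rule cINF_greatest[OF ne]) (use main in \<open>auto simp: algebra_simps\<close>)
  then show "?E \<le> (INF X \<in> weighted_class n m r p. expected_loss n m loss Y p X)
     + 120 * (l + b) * root 3 (r * real n * ln (real n) / real s)"
    unfolding \<rho>_def by linarith
qed

end
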